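(* For every formula $\phi$ there is (effectively computable from $\phi$) a formula $\psi$ in disjunctive normal form such that $\vdash_{\mathbf{MP}^*}\phi\leftrightarrow\psi$.
   Context: Formulas: built from a countable set $\mathsf{A}$ of atomic formulas (containing $\top,\bot$) by $\land,\neg,\Box,\mathsf{K}$; $\Diamond\phi:=\neg\Box\neg\phi$, $\mathsf{L}\phi:=\neg\mathsf{K}\neg\phi$. $\mathcal{L}'$ is the least set of formulas containing $\mathsf{A}$ and closed under $\land$, $\neg$ and $\phi\mapsto\Diamond\mathsf{K}\phi$. A formula is in prime normal form if it has the form $\psi\land\mathsf{K}\psi'\land\bigwedge_{i=1}^n\mathsf{L}\psi_i$ with $\psi,\psi',\psi_i\in\mathcal{L}'$ and $n$ finite; it is in disjunctive normal form if it is a finite disjunction of formulas in prime normal form. The system $\mathbf{MP}^*$ has rules modus ponens, $\mathsf{K}$-necessitation, $\Box$-necessitation and axioms all instances of: (1) propositional tautologies; (2) $(A\to\Box A)\land(\neg A\to\Box\neg A)$ for atomic $A$; (3) $\Box(\phi\to\psi)\to(\Box\phi\to\Box\psi)$; (4) $\Box\phi\to\phi$; (5) $\Box\phi\to\Box\Box\phi$; (6) $\mathsf{K}(\phi\to\psi)\to(\mathsf{K}\phi\to\mathsf{K}\psi)$; (7) $\mathsf{K}\phi\to\phi$; (8) $\mathsf{K}\phi\to\mathsf{K}\mathsf{K}\phi$; (9) $\phi\to\mathsf{K}\mathsf{L}\phi$; (10) $\mathsf{K}\Box\phi\to\Box\mathsf{K}\phi$; (11) $\Diamond\Box\phi\to\Box\Diamond\phi$;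 (12) $\Diamond(\mathsf{K}\phi\land\psi)\land\mathsf{L}\Diamond(\mathsf{K}\phi\land\chi)\to\Diamond(\mathsf{K}\Diamond\phi\land\Diamond\psi\land\mathsf{L}\Diamond\chi)$. *)

theory Defs
  imports Main "HOL-Library.Nat_Bijection"
begin

text \<open>
  The type \<open>'a\<close> plays the role of the set of atomic formulas. Its two distinguished
  elements, verum and falsum, are passed as parameters \<open>tt\<close> and \<open>ff\<close> where they matter;
  countability is given by an injective numbering \<open>code\<close> of \<open>'a\<close>.
\<close>

datatype 'a fm =
    Atom 'a
  | Neg "'a fm"
  | And "'a fm" "'a fm"
  | Box "'a fm"
  | Know "'a fm"

definition Or :: "'a fm \<Rightarrow> 'a fm \<Rightarrow> 'a fm" where
  "Or \<phi> \<psi> = Neg (And (Neg \<phi>) (Neg \<psi>))"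

definition Imp :: "'a fm \<Rightarrow> 'a fm \<Rightarrow> 'a fm" where
  "Imp \<phi> \<psi> = Neg (And \<phi> (Neg \<psi>))"

definition Iff :: "'a fm \<Rightarrow> 'a fm \<Rightarrow> 'a fm" where
  "Iff \<phi> \<psi> = And (Imp \<phi> \<psi>) (Imp \<psi> \<phi>)"

definition Dia :: "'a fm \<Rightarrow> 'a fm" where
  "Dia \<phi> = Neg (Box (Neg \<phi>))"

definition Poss :: "'a fm \<Rightarrow> 'a fm" where
  "Poss \<phi> = Neg (Know (Neg \<phi>))"

text \<open>
  For propositional purposes the atoms and the formulas of the form \<open>Box \<phi>\<close>, \<open>Know \<phi>\<close>
  are the indecomposable units; a valuation is only consulted on those.
\<close>

primrec prop_eval :: "('a fm \<Rightarrow> bool) \<Rightarrow> 'a fm \<Rightarrow> bool" where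
  "prop_eval v (Atom a) = v (Atom a)"
| "prop_eval v (Neg \<phi>) = (\<not> prop_eval v \<phi>)"
| "prop_eval v (And \<phi> \<psi>) = (prop_eval v \<phi> \<and> prop_eval v \<psi>)"
| "prop_eval v (Box \<phi>) = v (Box \<phi>)"
| "prop_eval v (Know \<phi>) = v (Know \<phi>)"

definition tautology :: "'a \<Rightarrow> 'a \<Rightarrow> 'a fm \<Rightarrow> bool" where
  "tautology tt ff \<phi> \<longleftrightarrow> (\<forall>v. v (Atom tt) \<and> \<not> v (Atom ff) \<longrightarrow> prop_eval v \<phi>)"

inductive MPstar :: "'a \<Rightarrow> 'a \<Rightarrow> 'a fm \<Rightarrow> bool" for tt ff :: 'a where
  Taut: "tautology tt ff \<phi> \<Longrightarrow> MPstar tt ff \<phi>"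
| AtomStable: "MPstar tt ff (And (Imp (Atom a) (Box (Atom a)))
                                 (Imp (Neg (Atom a)) (Box (Neg (Atom a)))))"
| BoxK: "MPstar tt ff (Imp (Box (Imp \<phi> \<psi>)) (Imp (Box \<phi>) (Box \<psi>)))"
| BoxT: "MPstar tt ff (Imp (Box \<phi>) \<phi>)"
| Box4: "MPstar tt ff (Imp (Box \<phi>) (Box (Box \<phi>)))"
| KnowK: "MPstar tt ff (Imp (Know (Imp \<phi> \<psi>)) (Imp (Know \<phi>) (Know \<psi>)))"
| KnowT: "MPstar tt ff (Imp (Know \<phi>) \<phi>)"
| Know4: "MPstar tt ff (Imp (Know \<phi>) (Know (Know \<phi>)))"
| KnowB: "MPstar tt ff (Imp \<phi> (Know (Poss \<phi>)))"
| Cross: "MPstar tt ff (Imp (Know (Box \<phi>)) (Box (Know \<phi>)))"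
| Directed: "MPstar tt ff (Imp (Dia (Box \<phi>)) (Box (Dia \<phi>)))"
| Union: "MPstar tt ff
    (Imp (And (Dia (And (Know \<phi>) \<psi>)) (Poss (Dia (And (Know \<phi>) \<chi>))))
         (Dia (And (And (Know (Dia \<phi>)) (Dia \<psi>)) (Poss (Dia \<chi>)))))"
| MP: "MPstar tt ff (Imp \<phi> \<psi>) \<Longrightarrow> MPstar tt ff \<phi> \<Longrightarrow> MPstar tt ff \<psi>"
| KnowNec: "MPstar tt ff \<phi> \<Longrightarrow> MPstar tt ff (Know \<phi>)"
| BoxNec: "MPstar tt ff \<phi> \<Longrightarrow> MPstar tt ff (Box \<phi>)"

inductive_set Lprime :: "'a fm set" where
  "Atom a \<in> Lprime"
| "\<phi> \<in> Lprime \<Longrightarrow> \<psi> \<in> Lprime \<Longrightarrow> And \<phi> \<psi> \<in> Lprime"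
| "\<phi> \<in> Lprime \<Longrightarrow> Neg \<phi> \<in> Lprime"
| "\<phi> \<in> Lprime \<Longrightarrow> Dia (Know \<phi>) \<in> Lprime"

text \<open>Iterated conjunctions and disjunctions associate to the left; \<open>n = 0\<close> is allowed below.\<close>

definition prime_nf :: "'a fm \<Rightarrow> bool" where
  "prime_nf \<phi> \<longleftrightarrow> (\<exists>\<psi> \<psi>' \<psi>s. \<psi> \<in> Lprime \<and> \<psi>' \<in> Lprime \<and> set \<psi>s \<subseteq> Lprime \<and>
     \<phi> = foldl And (And \<psi> (Know \<psi>')) (map Poss \<psi>s))"

text \<open>Disjunctions are required to be nonempty, so that no choice of an empty disjunction is needed.\<close>

definition disjunctive_nf :: "'a fm \<Rightarrow> bool" where
  "disjunctive_nf \<phi> \<longleftrightarrow> (\<exists>\<delta> \<delta>s. prime_nf \<delta> \<and> (\<forall>\<epsilon>\<in>set \<delta>s. prime_nf \<epsilon>) \<and> \<phi> = foldl Or \<delta> \<delta>s)"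

text \<open>
  Total \<open>\<mu>\<close>-recursive functions of arity \<open>n\<close>, with minimisation restricted to regular
  functions. Arguments are lists of length \<open>n\<close>; by rule \<open>ext\<close> the values on lists of any
  other length are irrelevant.
\<close>

inductive recursive_fn :: "nat \<Rightarrow> (nat list \<Rightarrow> nat) \<Rightarrow> bool" where
  zero: "recursive_fn n (\<lambda>xs. 0)"
| succ: "recursive_fn 1 (\<lambda>xs. Suc (xs ! 0))"
| proj: "i < n \<Longrightarrow> recursive_fn n (\<lambda>xs. xs ! i)"
| comp: "recursive_fn (length fs) g \<Longrightarrow> \<forall>f\<in>set fs. recursive_fn n f \<Longrightarrow>
    recursive_fn n (\<lambda>xs. g (map (\<lambda>f. f xs) fs))"
| prim_rec: "recursive_fn n g \<Longrightarrow> recursive_fn (Suc (Suc n)) h \<Longrightarrow>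
    recursive_fn (Suc n) (\<lambda>xs. rec_nat (g (tl xs)) (\<lambda>k r. h (k # r # tl xs)) (hd xs))"
| minimise: "recursive_fn (Suc n) g \<Longrightarrow> \<forall>xs. length xs = n \<longrightarrow> (\<exists>y. g (y # xs) = 0) \<Longrightarrow>
    recursive_fn n (\<lambda>xs. LEAST y. g (y # xs) = 0)"
| ext: "recursive_fn n f \<Longrightarrow> \<forall>xs. length xs = n \<longrightarrow> f xs = g xs \<Longrightarrow> recursive_fn n g"

primrec goedel :: "('a \<Rightarrow> nat) \<Rightarrow> 'a fm \<Rightarrow> nat" where
  "goedel code (Atom a) = prod_encode (0, code a)"
| "goedel code (Neg \<phi>) = prod_encode (1, goedel code \<phi>)"
| "goedel code (And \<phi> \<psi>) = prod_encode (2, prod_encode (goedel code \<phi>, goedel code \<psi>))"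
| "goedel code (Box \<phi>) = prod_encode (3, goedel code \<phi>)"
| "goedel code (Know \<phi>) = prod_encode (4, goedel code \<phi>)"

lemma inj_goedel:
  assumes "inj code"
  shows "inj (goedel code)"
proof (rule injI)
  fix \<phi> \<psi> :: "'a fm"
  show "goedel code \<phi> = goedel code \<psi> \<Longrightarrow> \<phi> = \<psi>"
  proof (induction \<phi> arbitrary: \<psi>)
    case (Atom a) then show ?case using assms by (cases \<psi>) (auto dest: injD)
  next
    case (Neg \<phi>) then show ?case by (cases \<psi>) auto
  next
    case (And \<phi>1 \<phi>2) then show ?case by (cases \<psi>) auto
  next
    case (Box \<phi>) then show ?case by (cases \<psi>) auto
  next
    case (Know \<phi>) then show ?case by (cases \<psi>) auto
  qed
qed

definition computable_fm :: "('a \<Rightarrow> nat) \<Rightarrow> ('a fm \<Rightarrow> 'a fm) \<Rightarrow> bool" where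
  "computable_fm code f \<longleftrightarrow>
     (\<exists>F. recursive_fn 1 F \<and> (\<forall>\<phi>. F [goedel code \<phi>] = goedel code (f \<phi>)))"

end

theory Submission
  imports Defs
begin

text \<open>
  Formulas of \<open>Lprime\<close> are persistent: they and their negations are preserved by \<open>Box\<close>, for
  \<open>Dia (Know \<phi>)\<close> by the cross axiom and directedness. Disjunctions of prime normal forms are
  closed under conjunction and negation by distributivity, and \<open>Poss\<close> turns \<open>a \<and> K b \<and> \<And> L c\<close> into
  \<open>K b \<and> L a \<and> \<And> L c\<close> by S5. The key case is
  \<open>\<diamond>(a \<and> K b \<and> \<And> L c) \<longleftrightarrow> a \<and> \<diamond>K b \<and> \<And> L (c \<and> \<diamond>K b)\<close>: from left to right by the cross axiom,
  from right to left by gluing with the union axiom the neighbourhoods on which \<open>b\<close> holds, where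
  persistence removes the diamonds which that axiom introduces. These operations on lists of
  triples \<open>(a, b, cs)\<close> are folds over lists and formulas, hence recursive on codes by
  course-of-values recursion.
\<close>

section \<open>Recursive functions of one argument\<close>

definition computable :: "(nat \<Rightarrow> nat) \<Rightarrow> bool" where
  "computable f \<longleftrightarrow> recursive_fn 1 (\<lambda>xs. f (xs ! 0))"

definition computable2 :: "(nat \<Rightarrow> nat \<Rightarrow> nat) \<Rightarrow> bool" where
  "computable2 f \<longleftrightarrow> recursive_fn 2 (\<lambda>xs. f (xs ! 0) (xs ! 1))"

section \<open>Composition and basic arithmetic\<close>

lemma recursive_fn_comp1:
  assumes "computable g" "recursive_fn n f"
  shows "recursive_fn n (\<lambda>xs. g (f xs))"
  using recursive_fn.comp[of "[f]" "\<lambda>xs. g (xs ! 0)" n] assms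
  by (simp add: computable_def)

lemma recursive_fn_comp2:
  assumes "computable2 g" "recursive_fn n f1" "recursive_fn n f2"
  shows "recursive_fn n (\<lambda>xs. g (f1 xs) (f2 xs))"
  using recursive_fn.comp[of "[f1, f2]" "\<lambda>xs. g (xs ! 0) (xs ! 1)" n] assms
  by (simp add: computable2_def numeral_2_eq_2)

lemma computable_comp: "computable g \<Longrightarrow> computable f \<Longrightarrow> computable (\<lambda>x. g (f x))"
  using recursive_fn_comp1[of g 1 "\<lambda>xs. f (xs ! 0)"] by (simp add: computable_def)

lemma computable_comp2:
  "computable2 g \<Longrightarrow> computable f1 \<Longrightarrow> computable f2 \<Longrightarrow> computable (\<lambda>x. g (f1 x) (f2 x))"
  using recursive_fn_comp2[of g 1 "\<lambda>xs. f1 (xs ! 0)" "\<lambda>xs. f2 (xs ! 0)"]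
  by (simp add: computable_def)

lemma computable_id: "computable (\<lambda>x. x)"
  unfolding computable_def by (rule recursive_fn.proj) simp

lemma computable_Suc: "computable f \<Longrightarrow> computable (\<lambda>x. Suc (f x))"
  using computable_comp[of Suc f] recursive_fn.succ unfolding computable_def by blast

lemma computable_const: "computable (\<lambda>x. k)"
proof (induction k)
  case 0
  show ?case unfolding computable_def by (rule recursive_fn.zero)
next
  case (Suc k)
  then show ?case by (rule computable_Suc)
qed

lemma computable2_rec_nat:
  assumes "computable g" "recursive_fn 3 (\<lambda>xs. h (xs ! 0) (xs ! 1) (xs ! 2))"
  shows "computable2 (\<lambda>x y. rec_nat (g y) (\<lambda>k r. h k r y) x)"
  unfolding computable2_def
\<comment> \<open>Primitive recursion is phrased with \<open>hd\<close> and \<open>tl\<close>, which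
  match indexing on lists of the right length; \<open>ext\<close> forgets all other lists.\<close>
proof (rule recursive_fn.ext)
  show "recursive_fn 2 (\<lambda>xs. rec_nat (g (tl xs ! 0))
      (\<lambda>k r. h ((k # r # tl xs) ! 0) ((k # r # tl xs) ! 1) ((k # r # tl xs) ! 2)) (hd xs))"
    using recursive_fn.prim_rec[of 1 "\<lambda>xs. g (xs ! 0)" "\<lambda>xs. h (xs ! 0) (xs ! 1) (xs ! 2)"] assms
    by (simp add: computable_def numeral_2_eq_2 numeral_3_eq_3)
qed (auto simp: hd_conv_nth nth_tl numeral_2_eq_2 length_Suc_conv)

lemma recursive_fn_Suc: "recursive_fn n f \<Longrightarrow> recursive_fn n (\<lambda>xs. Suc (f xs))"
  by (rule recursive_fn_comp1[OF computable_Suc[OF computable_id]])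

lemma computable2_add: "computable2 (+)"
proof -
  have "computable2 (\<lambda>x y. rec_nat y (\<lambda>k r. Suc r) x)"
    by (rule computable2_rec_nat[OF computable_id])
       (intro recursive_fn_Suc recursive_fn.proj; simp)
  moreover have "rec_nat y (\<lambda>k r. Suc r) x = x + y" for x y by (induction x) auto
  ultimately show ?thesis by simp
qed

lemma computable2_diff: "computable2 (-)"
proof -
  \<comment> \<open>Recursion that returns its counter \<open>k\<close> gives the predecessor, with
    value \<open>0\<close> at \<open>0\<close>.\<close>
  have "computable2 (\<lambda>x y. rec_nat 0 (\<lambda>k r. k) x)"
    by (rule computable2_rec_nat[OF computable_const]) (intro recursive_fn.proj; simp)
  from computable_comp2[OF this computable_id computable_id]
  have "computable (\<lambda>x. rec_nat 0 (\<lambda>k r. k) x)" .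
  moreover have "rec_nat 0 (\<lambda>k r. k) x = x - 1" for x by (cases x) auto
  ultimately have pred: "computable (\<lambda>x. x - 1)" by simp
  have "computable2 (\<lambda>x y. rec_nat y (\<lambda>k r. r - 1) x)"
    by (rule computable2_rec_nat[OF computable_id])
       (rule recursive_fn_comp1[OF pred], rule recursive_fn.proj, simp)
  moreover have "rec_nat y (\<lambda>k r. r - 1) x = y - x" for x y by (induction x) auto
  ultimately have "computable2 (\<lambda>x y. y - x)" by simp
  \<comment> \<open>The recursion ran over the subtrahend, which therefore came first; exchanging
    the projections restores the usual order.\<close>
  from recursive_fn_comp2[OF this, of 2 "\<lambda>xs. xs ! 1" "\<lambda>xs. xs ! 0"]
  show ?thesis by (simp add: computable2_def recursive_fn.proj)
qed

lemmas computable_add = computable_comp2[OF computable2_add]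
lemmas computable_diff = computable_comp2[OF computable2_diff]

section \<open>Cantor pairing and its projections\<close>

lemma computable_triangle: "computable triangle"
proof -
  have "computable2 (\<lambda>x y. rec_nat 0 (\<lambda>k r. r + Suc k) x)"
    by (rule computable2_rec_nat[OF computable_const])
       (intro recursive_fn_comp2[OF computable2_add] recursive_fn_Suc recursive_fn.proj; simp)
  from computable_comp2[OF this computable_id computable_id]
  have "computable (\<lambda>x. rec_nat 0 (\<lambda>k r. r + Suc k) x)" .
  moreover have "rec_nat 0 (\<lambda>k r. r + Suc k) x = triangle x" for x by (induction x) auto
  ultimately show ?thesis by simp
qed

lemma computable2_prod_encode: "computable2 (\<lambda>x y. prod_encode (x, y))"
  unfolding computable2_def prod_encode_def
  by (simp, intro recursive_fn_comp2[OF computable2_add] recursive_fn_comp1[OF computable_triangle]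
      recursive_fn.proj; simp)

lemmas computable_pair = computable_comp2[OF computable2_prod_encode]

definition pfst :: "nat \<Rightarrow> nat" where "pfst n = fst (prod_decode n)"
definition psnd :: "nat \<Rightarrow> nat" where "psnd n = snd (prod_decode n)"

lemma pfst_prod_encode [simp]: "pfst (prod_encode (x, y)) = x"
  by (simp add: pfst_def)

lemma psnd_prod_encode [simp]: "psnd (prod_encode (x, y)) = y"
  by (simp add: psnd_def)

lemma triangle_mono: "i \<le> j \<Longrightarrow> triangle i \<le> triangle j"
  by (induction j) (auto simp: le_Suc_eq)

text \<open>The antidiagonal of the Cantor pairing on which \<open>n\<close> lies, that is, the
  least \<open>s\<close> with \<open>n < triangle (Suc s)\<close>. The inequality is written as the
  vanishing of a truncated difference because minimisation searches for zeros.\<close>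

definition diagonal :: "nat \<Rightarrow> nat" where
  "diagonal n = (LEAST s. Suc n - triangle (Suc s) = 0)"

lemma diagonal_prod_encode: "diagonal (prod_encode (x, y)) = x + y"
  unfolding diagonal_def
proof (rule Least_equality)
  show "Suc (prod_encode (x, y)) - triangle (Suc (x + y)) = 0"
    by (simp add: prod_encode_def)
next
  fix s assume s: "Suc (prod_encode (x, y)) - triangle (Suc s) = 0"
  show "x + y \<le> s"
  proof (rule ccontr)
    assume "\<not> x + y \<le> s"
    then have "triangle (Suc s) \<le> triangle (x + y)" by (intro triangle_mono) simp
    with s show False by (simp add: prod_encode_def)
  qed
qed

lemma computable_diagonal: "computable diagonal"
  unfolding computable_def diagonal_def
proof (rule recursive_fn.ext)
  show "recursive_fn 1 (\<lambda>xs. LEAST s. Suc ((s # xs) ! 1) - triangle (Suc ((s # xs) ! 0)) = 0)"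
  proof (rule recursive_fn.minimise)
    show "recursive_fn (Suc 1) (\<lambda>xs. Suc (xs ! 1) - triangle (Suc (xs ! 0)))"
      by (intro recursive_fn_comp2[OF computable2_diff] recursive_fn_comp1[OF computable_triangle]
          recursive_fn_Suc recursive_fn.proj; simp)
    \<comment> \<open>Regularity of the search: \<open>y = xs ! 0\<close> is a zero, since
      \<open>Suc n \<le> triangle (Suc n)\<close>.\<close>
    have "n \<le> triangle n" for n by (induction n) auto
    then show "\<forall>xs. length xs = 1 \<longrightarrow>
        (\<exists>y. Suc ((y # xs) ! 1) - triangle (Suc ((y # xs) ! 0)) = 0)"
      by (metis diff_is_0_eq nth_Cons_0 nth_Cons_Suc One_nat_def)
  qed
qed simp

text \<open>As \<open>prod_encode (x, y) = triangle (x + y) + x\<close>, the first component is the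
  offset from the start of the antidiagonal; the second is then what is missing to
  \<open>x + y\<close>.\<close>

lemma computable_pfst: "computable f \<Longrightarrow> computable (\<lambda>x. pfst (f x))"
proof (rule computable_comp[of pfst])
  have "pfst n = n - triangle (diagonal n)" for n
  proof -
    obtain x y where n: "n = prod_encode (x, y)" by (metis prod_decode_inverse surj_pair)
    show ?thesis unfolding n diagonal_prod_encode by (simp only: pfst_prod_encode) (simp add: prod_encode_def)
  qed
  then show "computable pfst"
    using computable_diff[OF computable_id computable_comp[OF computable_triangle computable_diagonal]]
    by presburger
qed

lemma computable_psnd: "computable f \<Longrightarrow> computable (\<lambda>x. psnd (f x))"
proof (rule computable_comp[of psnd])
  have "psnd n = diagonal n - pfst n" for n
  proof -
    obtain x y where n: "n = prod_encode (x, y)" by (metis prod_decode_inverse surj_pair)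
    show ?thesis unfolding n diagonal_prod_encode by simp
  qed
  then show "computable psnd"
    using computable_diff[OF computable_diagonal computable_pfst[OF computable_id]]
    by presburger
qed

section \<open>Recursion with packed arguments, case distinction, course-of-values recursion\<close>

lemma computable_rec_nat:
  assumes "computable g" "computable h" "computable n" "computable p"
  shows "computable (\<lambda>z. rec_nat (g (p z))
           (\<lambda>k r. h (prod_encode (k, prod_encode (r, p z)))) (n z))"
proof -
  have "computable2 (\<lambda>x y. rec_nat (g y) (\<lambda>k r. h (prod_encode (k, prod_encode (r, y)))) x)"
    by (rule computable2_rec_nat[OF assms(1)], rule recursive_fn_comp1[OF assms(2)])
       (intro recursive_fn_comp2[OF computable2_prod_encode] recursive_fn.proj; simp)
  from computable_comp2[OF this assms(3,4)] show ?thesis .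
qed

text \<open>A case distinction is a recursion of length \<open>c z\<close> that starts at
  \<open>f z\<close> and whose step ignores the previous value and returns
  \<open>g z\<close>.\<close>

lemma computable_if:
  assumes "computable c" "computable f" "computable g"
  shows "computable (\<lambda>z. if c z = 0 then f z else g z)"
proof -
  have "computable (\<lambda>z. rec_nat (f z)
           (\<lambda>k r. g (psnd (psnd (prod_encode (k, prod_encode (r, z)))))) (c z))"
    by (rule computable_rec_nat)
       (intro assms computable_comp[OF assms(3)] computable_psnd computable_id)+
  moreover have "rec_nat (f z) (\<lambda>k r. g z) (c z) = (if c z = 0 then f z else g z)" for z
    by (cases "c z") auto
  ultimately show ?thesis by simp
qed

lemma computable_if_less:
  assumes "computable a" "computable b" "computable f" "computable g"
  shows "computable (\<lambda>z. if a z < b z then f z else g z)"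
proof -
  have "(if b z - a z = 0 then g z else f z) = (if a z < b z then f z else g z)" for z
    by auto
  then show ?thesis
    using computable_if[OF computable_diff[OF assms(2,1)] assms(4,3)] by simp
qed

lemma computable_if_eq:
  assumes "computable a" "computable f" "computable g"
  shows "computable (\<lambda>z. if a z = k then f z else g z)"
proof -
  have "(if (a z - k) + (k - a z) = 0 then f z else g z) = (if a z = k then f z else g z)" for z
    by auto
  then show ?thesis
    using computable_if[OF computable_add[OF computable_diff[OF assms(1) computable_const[of k]]
          computable_diff[OF computable_const[of k] assms(1)]] assms(2,3)] by presburger
qed

text \<open>A child \<open>a n\<close> or \<open>b n\<close> that is not smaller than \<open>n\<close> contributes the junk value \<open>0\<close>.\<close>

function tree_rec :: "(nat \<Rightarrow> nat) \<Rightarrow> (nat \<Rightarrow> nat) \<Rightarrow> (nat \<Rightarrow> nat) \<Rightarrow> nat \<Rightarrow> nat \<Rightarrow> nat" where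
  "tree_rec G a b p n = G (prod_encode (p, prod_encode (n, prod_encode
     (if a n < n then tree_rec G a b p (a n) else 0,
      if b n < n then tree_rec G a b p (b n) else 0))))"
  by auto
termination by (relation "measure (\<lambda>(G, a, b, p, n). n)") auto

declare tree_rec.simps [simp del]

text \<open>Histories are stacks of nested pairs with the latest value on top, so depth counts
  backwards in time: in a history of length \<open>n\<close> the value at \<open>m\<close> lies at
  depth \<open>n - Suc m\<close>.\<close>

definition lookup :: "nat \<Rightarrow> nat \<Rightarrow> nat" where
  "lookup h k = pfst ((psnd ^^ k) h)"

primrec history :: "(nat \<Rightarrow> nat) \<Rightarrow> nat \<Rightarrow> nat" where
  "history f 0 = 0"
| "history f (Suc n) = prod_encode (f n, history f n)"

lemma lookup_history: "m < n \<Longrightarrow> lookup (history f n) (n - Suc m) = f m"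
proof (induction n)
  case (Suc n)
  show ?case
  proof (cases "m = n")
    case False
    with Suc.prems have "Suc n - Suc m = Suc (n - Suc m)" by simp
    with False Suc show ?thesis by (simp add: lookup_def funpow_Suc_right del: funpow.simps)
  qed (simp add: lookup_def)
qed simp

lemma computable_lookup:
  assumes "computable h" "computable k"
  shows "computable (\<lambda>z. lookup (h z) (k z))"
proof -
  have "computable (\<lambda>z. rec_nat (h z)
      (\<lambda>i r. psnd (pfst (psnd (prod_encode (i, prod_encode (r, h z)))))) (k z))"
    by (rule computable_rec_nat)
       (intro assms computable_psnd computable_pfst computable_id)+
  moreover have "rec_nat x (\<lambda>i r. psnd r) n = (psnd ^^ n) x" for x n by (induction n) auto
  ultimately have "computable (\<lambda>z. (psnd ^^ k z) (h z))" by simp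
  then show ?thesis unfolding lookup_def by (rule computable_pfst)
qed

text \<open>Course-of-values recursion becomes primitive recursion by computing the whole history:
  the recursive calls turn into lookups, and the result is the top entry of the history of length
  \<open>Suc (n z)\<close>.\<close>

lemma computable_tree_rec:
  assumes G: "computable G" and a: "computable a" and b: "computable b"
    and p: "computable p" and n: "computable n"
  shows "computable (\<lambda>z. tree_rec G a b (p z) (n z))"
proof -
  define child where "child c k r = (if c k < k then lookup r (k - Suc (c k)) else 0)" for c k r
  define step where "step k r q = prod_encode (G (prod_encode (q, prod_encode (k,
    prod_encode (child a k r, child b k r)))), r)" for k r q
  have child: "computable (\<lambda>z. child c (k z) (r z))"
    if "computable c" "computable k" "computable r" for c k r
    unfolding child_def
    by (intro computable_if_less computable_comp[OF that(1)] computable_lookup computable_diff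
        computable_Suc computable_const that)
  have "computable (\<lambda>z. step (pfst z) (pfst (psnd z)) (psnd (psnd z)))"
    unfolding step_def
    by (intro computable_pair computable_comp[OF G] child a b computable_pfst computable_psnd
        computable_id)
  from computable_rec_nat[OF computable_const[of 0] this computable_Suc[OF n] p]
  have 1: "computable (\<lambda>z. rec_nat 0 (\<lambda>k r. step k r (p z)) (Suc (n z)))"
    by (simp only: pfst_prod_encode psnd_prod_encode)
  have "rec_nat 0 (\<lambda>k r. step k r q) m = history (tree_rec G a b q) m" for q m
  proof (induction m)
    case (Suc m)
    \<comment> \<open>Guard and default value of \<open>child\<close> copy those of
      \<open>tree_rec\<close>; under the guard the value looked up is already in the
      history.\<close>
    have "child c m (history (tree_rec G a b q) m)
        = (if c m < m then tree_rec G a b q (c m) else 0)" for c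
      by (simp add: child_def lookup_history)
    with Suc show ?case by (simp add: step_def tree_rec.simps[of G a b q m])
  qed simp
  then have "tree_rec G a b (p z) (n z) = pfst (rec_nat 0 (\<lambda>k r. step k r (p z)) (Suc (n z)))" for z
    by (metis history.simps(2) pfst_prod_encode)
  with computable_pfst[OF 1] show ?thesis by presburger
qed

section \<open>Computability relative to encodings\<close>

text \<open>The number function \<open>F\<close> is unconstrained on numbers that code nothing,
  which leaves room for junk values.\<close>

definition computable_enc :: "('a \<Rightarrow> nat) \<Rightarrow> ('b \<Rightarrow> nat) \<Rightarrow> ('a \<Rightarrow> 'b) \<Rightarrow> bool" where
  "computable_enc e e' f \<longleftrightarrow> (\<exists>F. computable F \<and> (\<forall>x. F (e x) = e' (f x)))"

definition enc_pair :: "('a \<Rightarrow> nat) \<Rightarrow> ('b \<Rightarrow> nat) \<Rightarrow> 'a \<times> 'b \<Rightarrow> nat" where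
  "enc_pair e e' = (\<lambda>(x, y). prod_encode (e x, e' y))"

definition enc_list :: "('a \<Rightarrow> nat) \<Rightarrow> 'a list \<Rightarrow> nat" where
  "enc_list e xs = list_encode (map e xs)"

lemma computable_encI:
  "computable F \<Longrightarrow> (\<And>x. F (e x) = e' (f x)) \<Longrightarrow> computable_enc e e' f"
  by (auto simp: computable_enc_def)

lemma computable_enc_comp:
  assumes "computable_enc e' e'' g" "computable_enc e e' f"
  shows "computable_enc e e'' (\<lambda>x. g (f x))"
proof -
  from assms obtain F G where F: "computable F" "\<And>x. F (e x) = e' (f x)"
    and G: "computable G" "\<And>x. G (e' x) = e'' (g x)"
    unfolding computable_enc_def by blast
  show ?thesis by (rule computable_encI[OF computable_comp[OF G(1) F(1)]]) (simp add: F G)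
qed

lemma computable_enc_id: "computable_enc e e (\<lambda>x. x)"
  by (rule computable_encI[OF computable_id]) simp

lemma computable_enc_const: "computable_enc e e' (\<lambda>x. k)"
  by (rule computable_encI[OF computable_const[of "e' k"]]) simp

lemma computable_enc_Pair:
  assumes "computable_enc e e1 f" "computable_enc e e2 g"
  shows "computable_enc e (enc_pair e1 e2) (\<lambda>x. (f x, g x))"
proof -
  from assms obtain F G where "computable F" "\<And>x. F (e x) = e1 (f x)"
    "computable G" "\<And>x. G (e x) = e2 (g x)"
    unfolding computable_enc_def by blast
  then show ?thesis
    by (intro computable_encI[of "\<lambda>x. prod_encode (F x, G x)"] computable_pair)
       (auto simp: enc_pair_def)
qed

lemma computable_enc_fst:
  "computable_enc e (enc_pair e1 e2) f \<Longrightarrow> computable_enc e e1 (\<lambda>x. fst (f x))"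
  by (erule computable_enc_comp[rotated], rule computable_encI[OF computable_pfst[OF computable_id]])
     (auto simp: enc_pair_def)

lemma computable_enc_snd:
  "computable_enc e (enc_pair e1 e2) f \<Longrightarrow> computable_enc e e2 (\<lambda>x. snd (f x))"
  by (erule computable_enc_comp[rotated], rule computable_encI[OF computable_psnd[OF computable_id]])
     (auto simp: enc_pair_def)

section \<open>Computable operations on lists\<close>

lemma computable_enc_Cons:
  assumes "computable_enc e e' f" "computable_enc e (enc_list e') g"
  shows "computable_enc e (enc_list e') (\<lambda>x. f x # g x)"
proof -
  from assms obtain F G where "computable F" "\<And>x. F (e x) = e' (f x)"
    "computable G" "\<And>x. G (e x) = enc_list e' (g x)"
    unfolding computable_enc_def by blast
  then show ?thesis
    by (intro computable_encI[of "\<lambda>x. Suc (prod_encode (F x, G x))"] computable_Suc computable_pair)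
       (auto simp: enc_list_def)
qed

text \<open>The code of \<open>x # l\<close> is the successor of a pair whose second component is
  the code of \<open>l\<close>, a smaller number. So a fold is a tree recursion along tails, with
  the code of the context \<open>c\<close> as its fixed parameter.\<close>

lemma computable_enc_foldr:
  assumes xs: "computable_enc e (enc_list e1) xs" and i: "computable_enc e e2 i"
    and g: "computable_enc (enc_pair e (enc_pair e1 e2)) e2 (\<lambda>z. g (fst z) (fst (snd z)) (snd (snd z)))"
  shows "computable_enc e e2 (\<lambda>c. foldr (g c) (xs c) (i c))"
proof -
  from xs obtain X where X: "computable X" "\<And>c. X (e c) = enc_list e1 (xs c)"
    unfolding computable_enc_def by blast
  from i obtain I where I: "computable I" "\<And>c. I (e c) = e2 (i c)"
    unfolding computable_enc_def by blast
  from g obtain S where S: "computable S"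
    "\<And>c x y. S (prod_encode (e c, prod_encode (e1 x, e2 y))) = e2 (g c x y)"
    unfolding computable_enc_def enc_pair_def by auto
  \<comment> \<open>Here \<open>pfst z\<close> is the context and \<open>pfst (psnd z)\<close> the
    list code, which is \<open>0\<close> exactly for the empty list. Both children are taken to be
    the tail, and the value at the first one is read.\<close>
  define G where "G z = (if pfst (psnd z) = 0 then I (pfst z)
    else S (prod_encode (pfst z, prod_encode (pfst (pfst (psnd z) - 1), pfst (psnd (psnd z))))))" for z
  define a where "a n = psnd (n - 1)" for n
  have G: "G (prod_encode (q, prod_encode (n, prod_encode (y, y')))) =
      (if n = 0 then I q else S (prod_encode (q, prod_encode (pfst (n - 1), y))))" for q n y y'
    by (simp add: G_def)
  have "computable G" unfolding G_def
    by (intro computable_if computable_comp[OF I(1)] computable_comp[OF S(1)] computable_pair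
        computable_pfst computable_psnd computable_diff computable_id computable_const)
  moreover have "computable a" unfolding a_def
    by (intro computable_psnd computable_diff computable_id computable_const)
  ultimately have "computable (\<lambda>z. tree_rec G a a z (X z))"
    by (intro computable_tree_rec computable_id X(1))
  moreover have "tree_rec G a a (e c) (enc_list e1 l) = e2 (foldr (g c) l (i c))" for c l
  proof (induction l)
    case Nil
    show ?case by (simp add: tree_rec.simps[of G] enc_list_def) (simp add: G I(2))
  next
    case (Cons x l)
    have "a (enc_list e1 (x # l)) = enc_list e1 l"
      by (simp add: a_def enc_list_def)
    moreover have "enc_list e1 l < enc_list e1 (x # l)"
      by (simp add: enc_list_def le_imp_less_Suc le_prod_encode_2)
    ultimately have "tree_rec G a a (e c) (enc_list e1 (x # l)) = G (prod_encode (e c, prod_encode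
       (enc_list e1 (x # l), prod_encode (e2 (foldr (g c) l (i c)), e2 (foldr (g c) l (i c))))))"
      by (simp add: tree_rec.simps[of G a a "e c" "enc_list e1 (x # l)"] Cons)
    then show ?case by (simp add: G S(2)) (simp add: enc_list_def S(2))
  qed
  ultimately show ?thesis by (intro computable_encI) (auto simp: X(2))
qed

lemma computable_enc_map:
  assumes "computable_enc e (enc_list e1) xs"
    and "computable_enc (enc_pair e e1) e2 (\<lambda>z. g (fst z) (snd z))"
  shows "computable_enc e (enc_list e2) (\<lambda>c. map (g c) (xs c))"
proof -
  have "computable_enc e (enc_list e2) (\<lambda>c. foldr (\<lambda>x ys. g c x # ys) (xs c) [])"
  proof (intro computable_enc_foldr[OF assms(1)] computable_enc_Cons computable_enc_const)
    have "computable_enc (enc_pair e (enc_pair e1 (enc_list e2))) (enc_pair e e1)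
        (\<lambda>z. (fst z, fst (snd z)))"
      by (rule computable_enc_Pair computable_enc_fst computable_enc_snd computable_enc_id)+
    from computable_enc_comp[OF assms(2) this]
    show "computable_enc (enc_pair e (enc_pair e1 (enc_list e2))) e2
        (\<lambda>z. g (fst z) (fst (snd z)))" by simp
  qed (rule computable_enc_snd computable_enc_id)+
  moreover have "foldr (\<lambda>x ys. g c x # ys) l [] = map (g c) l" for c l
    by (induction l) auto
  ultimately show ?thesis by simp
qed

lemma computable_enc_append:
  assumes "computable_enc e (enc_list e1) xs" "computable_enc e (enc_list e1) ys"
  shows "computable_enc e (enc_list e1) (\<lambda>c. xs c @ ys c)"
proof -
  have "computable_enc e (enc_list e1) (\<lambda>c. foldr (\<lambda>x l. x # l) (xs c) (ys c))"
    by (intro computable_enc_foldr[OF assms] computable_enc_Cons)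
       (rule computable_enc_fst computable_enc_snd computable_enc_id)+
  moreover have "foldr (#) xs ys = xs @ ys" for xs ys :: "'b list" by (induction xs) auto
  ultimately show ?thesis by simp
qed

lemma computable_enc_concat:
  assumes "computable_enc e (enc_list (enc_list e1)) xss"
  shows "computable_enc e (enc_list e1) (\<lambda>c. concat (xss c))"
  unfolding concat_conv_foldr
  by (intro computable_enc_foldr[OF assms] computable_enc_append computable_enc_const)
     (rule computable_enc_fst computable_enc_snd computable_enc_id)+

section \<open>Computability on Goedel numbers of formulas\<close>

lemma computable_enc_goedel:
  assumes "computable_enc e (goedel code) f" "computable_enc e (goedel code) g"
  shows "computable_enc e (goedel code) (\<lambda>x. Neg (f x))"
    and "computable_enc e (goedel code) (\<lambda>x. And (f x) (g x))"
    and "computable_enc e (goedel code) (\<lambda>x. Box (f x))"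
    and "computable_enc e (goedel code) (\<lambda>x. Know (f x))"
proof -
  from assms obtain F G where F: "computable F" "\<And>x. F (e x) = goedel code (f x)"
    and G: "computable G" "\<And>x. G (e x) = goedel code (g x)"
    unfolding computable_enc_def by blast
  show "computable_enc e (goedel code) (\<lambda>x. And (f x) (g x))"
    by (rule computable_encI[of "\<lambda>x. prod_encode (2, prod_encode (F x, G x))"])
       (intro computable_pair computable_const F(1) G(1), simp add: F(2) G(2))
  have tag: "computable (\<lambda>x. prod_encode (t, F x))" for t
    by (intro computable_pair computable_const F(1))
  show "computable_enc e (goedel code) (\<lambda>x. Neg (f x))"
    by (rule computable_encI[OF tag[of 1]]) (simp add: F(2))
  show "computable_enc e (goedel code) (\<lambda>x. Box (f x))"
    by (rule computable_encI[OF tag[of 3]]) (simp add: F(2))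
  show "computable_enc e (goedel code) (\<lambda>x. Know (f x))"
    by (rule computable_encI[OF tag[of 4]]) (simp add: F(2))
qed

text \<open>Structural recursion on formulas is tree recursion on Goedel numbers, branching on the
  tag. The atomic case receives the code of the whole formula \<open>Atom a\<close>.\<close>

lemma computable_enc_rec_fm:
  assumes atom: "computable_enc (goedel code) e (\<lambda>\<phi>. fA \<phi>)" "\<And>a. f (Atom a) = fA (Atom a)"
    and neg: "computable_enc e e fN" "\<And>\<phi>. f (Neg \<phi>) = fN (f \<phi>)"
    and conj: "computable_enc (enc_pair e e) e (\<lambda>z. fC (fst z) (snd z))"
      "\<And>\<phi> \<psi>. f (And \<phi> \<psi>) = fC (f \<phi>) (f \<psi>)"
    and box: "computable_enc e e fB" "\<And>\<phi>. f (Box \<phi>) = fB (f \<phi>)"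
    and know: "computable_enc e e fK" "\<And>\<phi>. f (Know \<phi>) = fK (f \<phi>)"
  shows "computable_enc (goedel code) e f"
proof -
  from atom obtain A where A: "computable A" "\<And>\<phi>. A (goedel code \<phi>) = e (fA \<phi>)"
    unfolding computable_enc_def by blast
  from neg obtain N where N: "computable N" "\<And>x. N (e x) = e (fN x)"
    unfolding computable_enc_def by blast
  from conj obtain C where C: "computable C" "\<And>x y. C (prod_encode (e x, e y)) = e (fC x y)"
    unfolding computable_enc_def enc_pair_def by auto
  from box obtain B where B: "computable B" "\<And>x. B (e x) = e (fB x)"
    unfolding computable_enc_def by blast
  from know obtain K where K: "computable K" "\<And>x. K (e x) = e (fK x)"
    unfolding computable_enc_def by blast
  define G where "G z = (let n = pfst (psnd z); x = pfst (psnd (psnd z)); y = psnd (psnd (psnd z)) in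
    if pfst n = 0 then A n else if pfst n = 1 then N x else if pfst n = 2 then C (prod_encode (x, y))
    else if pfst n = 3 then B x else K x)" for z
  \<comment> \<open>Below tag \<open>2\<close> the payload is a pair of codes and \<open>a\<close>,
    \<open>b\<close> are its components; below the unary tags the payload itself is the only child
    that matters.\<close>
  define a where "a n = (if pfst n = 2 then pfst (psnd n) else psnd n)" for n
  define b where "b n = psnd (psnd n)" for n
  have G: "G (prod_encode (q, prod_encode (prod_encode (t, m), prod_encode (x, y)))) =
      (if t = 0 then A (prod_encode (t, m)) else if t = 1 then N x
       else if t = 2 then C (prod_encode (x, y)) else if t = 3 then B x else K x)" for q t m x y
    by (simp add: G_def)
  have ab: "a (prod_encode (t, m)) = (if t = 2 then pfst m else m)"
    "b (prod_encode (t, m)) = psnd m" for t m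
    by (simp_all add: a_def b_def)
  have "computable G" unfolding G_def Let_def
    by (intro computable_if_eq computable_comp[OF A(1)] computable_comp[OF N(1)]
        computable_comp[OF C(1)] computable_comp[OF B(1)] computable_comp[OF K(1)] computable_pair
        computable_pfst computable_psnd computable_id)
  moreover have "computable a" unfolding a_def
    by (intro computable_if_eq computable_pfst computable_psnd computable_id)
  moreover have "computable b" unfolding b_def by (intro computable_psnd computable_id)
  ultimately have "computable (\<lambda>z. tree_rec G a b 0 z)"
    by (intro computable_tree_rec computable_id computable_const)
  moreover have "tree_rec G a b 0 (goedel code \<phi>) = e (f \<phi>)" for \<phi>
  proof -
    \<comment> \<open>The tag must be positive: \<open>prod_encode (0, 1)\<close> equals
      \<open>1\<close>. Tag \<open>0\<close> belongs to atoms, where \<open>G\<close> ignores the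
      values at the children.\<close>
    have less: "y < prod_encode (t, y)" if "t > 0" for t y
    proof -
      have "n \<le> triangle n" for n by (induction n) auto
      from this[of "t + y"] that show ?thesis by (simp add: prod_encode_def)
    qed
    have less1: "x < prod_encode (2, prod_encode (x, y))" for x y
      using less[of 2 "prod_encode (x, y)"] le_prod_encode_1[of x y] by simp
    have less2: "y < prod_encode (2, prod_encode (x, y))" for x y
      using less[of 2 "prod_encode (x, y)"] le_prod_encode_2[of y x] by simp
    show ?thesis
    proof (induction \<phi>)
      case (Atom x)
      show ?case using A(2)[of "Atom x"] by (subst tree_rec.simps) (simp add: G atom(2))
    next
      case (Neg \<phi>)
      then show ?case
        by (subst tree_rec.simps) (simp add: G ab less N(2) neg(2))
    next
      case (And \<phi> \<psi>)
      then show ?case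
        by (subst tree_rec.simps) (simp add: G ab less1 less2 C(2) conj(2))
    next
      case (Box \<phi>)
      then show ?case
        by (subst tree_rec.simps) (simp add: G ab less B(2) box(2))
    next
      case (Know \<phi>)
      then show ?case
        by (subst tree_rec.simps) (simp add: G ab less K(2) know(2))
    qed
  qed
  ultimately show ?thesis by (intro computable_encI) auto
qed

section \<open>Normal forms\<close>

text \<open>The triple \<open>(a, b, cs)\<close> stands for the formula in prime normal form with components
  \<open>a\<close>, \<open>Know b\<close> and \<open>Poss c\<close> for \<open>c\<close> in \<open>cs\<close>, and a list of triples for their disjunction.\<close>

type_synonym 'a prime = "'a fm \<times> 'a fm \<times> 'a fm list"

text \<open>Projections and \<open>foldr\<close>, rather than patterns and \<open>foldl\<close>, let
  the computability rules follow the body syntactically.\<close>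

definition prime_fm :: "'a prime \<Rightarrow> 'a fm" where
  "prime_fm p = foldr (\<lambda>c \<phi>. And \<phi> (Poss c)) (snd (snd p)) (And (fst p) (Know (fst (snd p))))"

text \<open>The innermost disjunct is itself in prime normal form and is false, so even the empty
  list yields a nonempty disjunction of the required shape.\<close>

definition dnf_fm :: "'a \<Rightarrow> 'a prime list \<Rightarrow> 'a fm" where
  "dnf_fm ff D = foldr (\<lambda>p \<phi>. Or \<phi> (prime_fm p)) D (And (Atom ff) (Know (Atom ff)))"

definition prime_and :: "'a prime \<Rightarrow> 'a prime \<Rightarrow> 'a prime" where
  "prime_and p q = (And (fst p) (fst q), And (fst (snd p)) (fst (snd q)), snd (snd p) @ snd (snd q))"

definition dnf_and :: "'a prime list \<Rightarrow> 'a prime list \<Rightarrow> 'a prime list" where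
  "dnf_and D E = concat (map (\<lambda>p. map (prime_and p) E) D)"

text \<open>De Morgan: the negation of \<open>a\<close>, \<open>Know b\<close> and all
  \<open>Poss c\<close> is the disjunction of \<open>Neg a\<close>, \<open>Poss (Neg b)\<close> and
  all \<open>Know (Neg c)\<close>, each padded with verum to a full triple.\<close>

definition prime_neg :: "'a \<Rightarrow> 'a prime \<Rightarrow> 'a prime list" where
  "prime_neg tt p = (Neg (fst p), Atom tt, []) # (Atom tt, Atom tt, [Neg (fst (snd p))]) #
     map (\<lambda>c. (Atom tt, Neg c, [])) (snd (snd p))"

definition dnf_neg :: "'a \<Rightarrow> 'a prime list \<Rightarrow> 'a prime list" where
  "dnf_neg tt D = foldr (\<lambda>p E. dnf_and (prime_neg tt p) E) D [(Atom tt, Atom tt, [])]"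

definition prime_poss :: "'a \<Rightarrow> 'a prime \<Rightarrow> 'a prime" where
  "prime_poss tt p = (Atom tt, fst (snd p), fst p # snd (snd p))"

text \<open>\<open>Dia (Know b)\<close> demands, at the current point and at each witness for a
  \<open>c\<close>, a neighbourhood on which \<open>b\<close> holds; the \<open>Know\<close> slot
  becomes trivial.\<close>

definition prime_dia :: "'a \<Rightarrow> 'a prime \<Rightarrow> 'a prime" where
  "prime_dia tt p = (And (fst p) (Dia (Know (fst (snd p)))), Atom tt,
     map (\<lambda>c. And c (Dia (Know (fst (snd p))))) (snd (snd p)))"

primrec dnf :: "'a \<Rightarrow> 'a fm \<Rightarrow> 'a prime list" where
  "dnf tt (Atom a) = [(Atom a, Atom tt, [])]"
| "dnf tt (Neg \<phi>) = dnf_neg tt (dnf tt \<phi>)"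
| "dnf tt (And \<phi> \<psi>) = dnf_and (dnf tt \<phi>) (dnf tt \<psi>)"
| "dnf tt (Box \<phi>) = dnf_neg tt (map (prime_dia tt) (dnf_neg tt (dnf tt \<phi>)))"
| "dnf tt (Know \<phi>) = dnf_neg tt (map (prime_poss tt) (dnf_neg tt (dnf tt \<phi>)))"

subsection \<open>Shape\<close>

definition Lprime_prime :: "'a prime \<Rightarrow> bool" where
  "Lprime_prime p \<longleftrightarrow> fst p \<in> Lprime \<and> fst (snd p) \<in> Lprime \<and> set (snd (snd p)) \<subseteq> Lprime"

lemma dnf_and_Lprime:
  "\<forall>p\<in>set D. Lprime_prime p \<Longrightarrow> \<forall>p\<in>set E. Lprime_prime p \<Longrightarrow> \<forall>p\<in>set (dnf_and D E). Lprime_prime p"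
  by (auto simp: dnf_and_def prime_and_def Lprime_prime_def intro!: Lprime.intros)

lemma dnf_neg_Lprime:
  "\<forall>p\<in>set D. Lprime_prime p \<Longrightarrow> \<forall>p\<in>set (dnf_neg tt D). Lprime_prime p"
proof (induction D)
  case Nil
  show ?case by (auto simp: dnf_neg_def Lprime_prime_def intro: Lprime.intros)
next
  case (Cons p D)
  have "\<forall>q\<in>set (prime_neg tt p). Lprime_prime q"
    using Cons.prems by (auto simp: prime_neg_def Lprime_prime_def intro!: Lprime.intros)
  moreover have "\<forall>q\<in>set (dnf_neg tt D). Lprime_prime q" using Cons by simp
  ultimately have "\<forall>q\<in>set (dnf_and (prime_neg tt p) (dnf_neg tt D)). Lprime_prime q"
    by (rule dnf_and_Lprime)
  moreover have "dnf_neg tt (p # D) = dnf_and (prime_neg tt p) (dnf_neg tt D)"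
    by (simp add: dnf_neg_def)
  ultimately show ?case by simp
qed

lemma map_Lprime:
  assumes "\<forall>p\<in>set D. Lprime_prime p"
  shows "\<forall>p\<in>set (map (prime_poss tt) D). Lprime_prime p"
    and "\<forall>p\<in>set (map (prime_dia tt) D). Lprime_prime p"
  using assms
  by (auto simp: prime_poss_def prime_dia_def Lprime_prime_def intro!: Lprime.intros)

text \<open>Besides the shape of the result, this supplies the persistence on which the
  \<open>Box\<close> case of the equivalence rests.\<close>

lemma dnf_Lprime: "\<forall>p\<in>set (dnf tt \<phi>). Lprime_prime p"
proof (induction \<phi>)
  case (Atom a)
  show ?case by (simp add: Lprime_prime_def Lprime.intros)
qed (unfold dnf.simps, (assumption | rule dnf_neg_Lprime dnf_and_Lprime map_Lprime)+)

lemma prime_nf_prime_fm: "Lprime_prime p \<Longrightarrow> prime_nf (prime_fm p)"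
  unfolding prime_nf_def prime_fm_def Lprime_prime_def
  \<comment> \<open>A \<open>foldr\<close> is a \<open>foldl\<close> over the reversed list, hence
    the witness with \<open>rev\<close>.\<close>
  by (intro exI[of _ "fst p"] exI[of _ "fst (snd p)"] exI[of _ "rev (snd (snd p))"])
     (simp add: foldr_conv_foldl foldl_map)

lemma disjunctive_nf_dnf_fm:
  assumes "\<forall>p\<in>set D. Lprime_prime p"
  shows "disjunctive_nf (dnf_fm ff D)"
proof -
  have "prime_nf (And (Atom ff) (Know (Atom ff)))"
    using prime_nf_prime_fm[of "(Atom ff, Atom ff, [])"]
    by (simp add: Lprime_prime_def Lprime.intros prime_fm_def)
  then show ?thesis
    using assms prime_nf_prime_fm unfolding disjunctive_nf_def dnf_fm_def
    by (intro exI[of _ "And (Atom ff) (Know (Atom ff))"] exI[of _ "map prime_fm (rev D)"])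
       (auto simp: foldr_conv_foldl foldl_map)
qed

subsection \<open>Derivations in the system\<close>

lemma prop_eval_connectives [simp]:
  "prop_eval v (Or \<phi> \<psi>) \<longleftrightarrow> prop_eval v \<phi> \<or> prop_eval v \<psi>"
  "prop_eval v (Imp \<phi> \<psi>) \<longleftrightarrow> (prop_eval v \<phi> \<longrightarrow> prop_eval v \<psi>)"
  "prop_eval v (Iff \<phi> \<psi>) \<longleftrightarrow> (prop_eval v \<phi> \<longleftrightarrow> prop_eval v \<psi>)"
  "prop_eval v (Dia \<phi>) \<longleftrightarrow> \<not> v (Box (Neg \<phi>))"
  "prop_eval v (Poss \<phi>) \<longleftrightarrow> \<not> v (Know (Neg \<phi>))"
  by (auto simp: Or_def Imp_def Iff_def Dia_def Poss_def)

lemma prop_eval_prime_fm: "prop_eval v (prime_fm p) \<longleftrightarrow>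
    prop_eval v (fst p) \<and> v (Know (fst (snd p))) \<and> (\<forall>c\<in>set (snd (snd p)). \<not> v (Know (Neg c)))"
proof -
  have "prop_eval v (foldr (\<lambda>c \<phi>. And \<phi> (Poss c)) cs \<psi>) \<longleftrightarrow>
      prop_eval v \<psi> \<and> (\<forall>c\<in>set cs. \<not> v (Know (Neg c)))" for cs \<psi>
    by (induction cs) auto
  then show ?thesis by (simp add: prime_fm_def)
qed

lemma prop_eval_dnf_fm:
  "\<not> v (Atom ff) \<Longrightarrow> prop_eval v (dnf_fm ff D) \<longleftrightarrow> (\<exists>p\<in>set D. prop_eval v (prime_fm p))"
  by (induction D) (auto simp: dnf_fm_def)


section \<open>Propositional and normal modal reasoning inside the system\<close>

context
  fixes tt ff :: 'a
begin

abbreviation (input) provable :: "'a fm \<Rightarrow> bool" ("\<turnstile> _" [40] 40) where "\<turnstile> \<phi> \<equiv> MPstar tt ff \<phi>"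

text \<open>The device for all propositional steps: the entailment is a tautological chain of
  implications from the theorems in \<open>\<Gamma>\<close>, discharged one by one by modus ponens.
  Formulas under \<open>Box\<close> or \<open>Know\<close> stay opaque, so modal facts have to be
  listed in \<open>\<Gamma>\<close>.\<close>

lemma prop_consequence:
  assumes "\<forall>\<gamma>\<in>set \<Gamma>. \<turnstile> \<gamma>"
    and "\<And>v. v (Atom tt) \<Longrightarrow> \<not> v (Atom ff) \<Longrightarrow> \<forall>\<gamma>\<in>set \<Gamma>. prop_eval v \<gamma> \<Longrightarrow> prop_eval v \<phi>"
  shows "\<turnstile> \<phi>"
  using assms
proof (induction \<Gamma> arbitrary: \<phi>)
  case Nil
  then show ?case by (intro MPstar.Taut) (auto simp: tautology_def)
next
  case (Cons \<gamma> \<Gamma>)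
  have "\<turnstile> Imp \<gamma> \<phi>" by (rule Cons.IH) (use Cons.prems in auto)
  with Cons.prems(1) show ?case by (auto intro: MPstar.MP)
qed

lemma Box_mono: "\<turnstile> Imp \<phi> \<psi> \<Longrightarrow> \<turnstile> Imp (Box \<phi>) (Box \<psi>)"
  by (rule MPstar.MP[OF MPstar.BoxK MPstar.BoxNec])

lemma Know_mono: "\<turnstile> Imp \<phi> \<psi> \<Longrightarrow> \<turnstile> Imp (Know \<phi>) (Know \<psi>)"
  by (rule MPstar.MP[OF MPstar.KnowK MPstar.KnowNec])

lemma Dia_mono:
  assumes "\<turnstile> Imp \<phi> \<psi>"
  shows "\<turnstile> Imp (Dia \<phi>) (Dia \<psi>)"
proof -
  have "\<turnstile> Imp (Neg \<psi>) (Neg \<phi>)" by (rule prop_consequence[of "[Imp \<phi> \<psi>]"]) (use assms in auto)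
  from Box_mono[OF this] show ?thesis
    by (intro prop_consequence[of "[Imp (Box (Neg \<psi>)) (Box (Neg \<phi>))]"]) auto
qed

lemma Poss_mono:
  assumes "\<turnstile> Imp \<phi> \<psi>"
  shows "\<turnstile> Imp (Poss \<phi>) (Poss \<psi>)"
proof -
  have "\<turnstile> Imp (Neg \<psi>) (Neg \<phi>)" by (rule prop_consequence[of "[Imp \<phi> \<psi>]"]) (use assms in auto)
  from Know_mono[OF this] show ?thesis
    by (intro prop_consequence[of "[Imp (Know (Neg \<psi>)) (Know (Neg \<phi>))]"]) auto
qed

lemma Imp_trans:
  assumes "\<turnstile> Imp \<phi> \<psi>" "\<turnstile> Imp \<psi> \<chi>"
  shows "\<turnstile> Imp \<phi> \<chi>"
  by (rule prop_consequence[of "[Imp \<phi> \<psi>, Imp \<psi> \<chi>]"]) (use assms in auto)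

lemma Iff_trans:
  assumes "\<turnstile> Iff \<phi> \<psi>" "\<turnstile> Iff \<psi> \<chi>"
  shows "\<turnstile> Iff \<phi> \<chi>"
  by (rule prop_consequence[of "[Iff \<phi> \<psi>, Iff \<psi> \<chi>]"]) (use assms in auto)

lemma IffI:
  assumes "\<turnstile> Imp \<phi> \<psi>" "\<turnstile> Imp \<psi> \<phi>"
  shows "\<turnstile> Iff \<phi> \<psi>"
  by (rule prop_consequence[of "[Imp \<phi> \<psi>, Imp \<psi> \<phi>]"]) (use assms in auto)

lemma IffD:
  assumes "\<turnstile> Iff \<phi> \<psi>"
  shows "\<turnstile> Imp \<phi> \<psi>" "\<turnstile> Imp \<psi> \<phi>"
  by (rule prop_consequence[of "[Iff \<phi> \<psi>]"]; use assms in auto)+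

lemma Iff_cong:
  assumes "\<turnstile> Iff \<phi> \<psi>"
  shows "\<turnstile> Iff (Neg \<phi>) (Neg \<psi>)" "\<turnstile> Iff (Box \<phi>) (Box \<psi>)" "\<turnstile> Iff (Know \<phi>) (Know \<psi>)"
    "\<turnstile> Iff (Dia \<phi>) (Dia \<psi>)" "\<turnstile> Iff (Poss \<phi>) (Poss \<psi>)"
proof -
  show "\<turnstile> Iff (Neg \<phi>) (Neg \<psi>)" by (rule prop_consequence[of "[Iff \<phi> \<psi>]"]) (use assms in auto)
qed (use IffD[OF assms] in \<open>blast intro: IffI Box_mono Know_mono Dia_mono Poss_mono\<close>)+

lemma Know_And: "\<turnstile> Iff (Know (And \<phi> \<psi>)) (And (Know \<phi>) (Know \<psi>))"
proof -
  have "\<turnstile> Imp (And \<phi> \<psi>) \<phi>" "\<turnstile> Imp (And \<phi> \<psi>) \<psi>" "\<turnstile> Imp \<phi> (Imp \<psi> (And \<phi> \<psi>))"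
    by (rule prop_consequence[of "[]"]; simp)+
  from Know_mono[OF this(1)] Know_mono[OF this(2)] Know_mono[OF this(3)] show ?thesis
    using MPstar.KnowK[of tt ff \<psi> "And \<phi> \<psi>"]
    by (intro prop_consequence[of "[Imp (Know (And \<phi> \<psi>)) (Know \<phi>), Imp (Know (And \<phi> \<psi>)) (Know \<psi>),
       Imp (Know \<phi>) (Know (Imp \<psi> (And \<phi> \<psi>))),
       Imp (Know (Imp \<psi> (And \<phi> \<psi>))) (Imp (Know \<psi>) (Know (And \<phi> \<psi>)))]"]) auto
qed

lemma Box_And: "\<turnstile> Iff (Box (And \<phi> \<psi>)) (And (Box \<phi>) (Box \<psi>))"
proof -
  have "\<turnstile> Imp (And \<phi> \<psi>) \<phi>" "\<turnstile> Imp (And \<phi> \<psi>) \<psi>" "\<turnstile> Imp \<phi> (Imp \<psi> (And \<phi> \<psi>))"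
    by (rule prop_consequence[of "[]"]; simp)+
  from Box_mono[OF this(1)] Box_mono[OF this(2)] Box_mono[OF this(3)] show ?thesis
    using MPstar.BoxK[of tt ff \<psi> "And \<phi> \<psi>"]
    by (intro prop_consequence[of "[Imp (Box (And \<phi> \<psi>)) (Box \<phi>), Imp (Box (And \<phi> \<psi>)) (Box \<psi>),
       Imp (Box \<phi>) (Box (Imp \<psi> (And \<phi> \<psi>))),
       Imp (Box (Imp \<psi> (And \<phi> \<psi>))) (Imp (Box \<psi>) (Box (And \<phi> \<psi>)))]"]) auto
qed

lemma Neg_Or: "\<turnstile> Iff (Neg (Or \<phi> \<psi>)) (And (Neg \<phi>) (Neg \<psi>))"
  by (rule prop_consequence[of "[]"]; simp)

lemma Poss_Or: "\<turnstile> Iff (Poss (Or \<phi> \<psi>)) (Or (Poss \<phi>) (Poss \<psi>))"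
  using Iff_cong(3)[OF Neg_Or] Know_And
  by (intro prop_consequence[of "[Iff (Know (Neg (Or \<phi> \<psi>))) (Know (And (Neg \<phi>) (Neg \<psi>))),
     Iff (Know (And (Neg \<phi>) (Neg \<psi>))) (And (Know (Neg \<phi>)) (Know (Neg \<psi>)))]"]) auto

lemma Dia_Or: "\<turnstile> Iff (Dia (Or \<phi> \<psi>)) (Or (Dia \<phi>) (Dia \<psi>))"
  using Iff_cong(2)[OF Neg_Or] Box_And
  by (intro prop_consequence[of "[Iff (Box (Neg (Or \<phi> \<psi>))) (Box (And (Neg \<phi>) (Neg \<psi>))),
     Iff (Box (And (Neg \<phi>) (Neg \<psi>))) (And (Box (Neg \<phi>)) (Box (Neg \<psi>)))]"]) auto

lemma Neg_Neg: "\<turnstile> Iff (Neg (Neg \<phi>)) \<phi>"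
  by (rule prop_consequence[of "[]"]; simp)

text \<open>\<open>Know (Neg \<mu>)\<close> refutes the left side, and \<open>Know \<mu>\<close>
  turns \<open>Know (Neg (And \<phi> \<mu>))\<close> into \<open>Know (Neg \<phi>)\<close>.
  \<open>Dia_And\<close> is the same argument for \<open>Box\<close>.\<close>

lemma Poss_And:
  assumes "\<turnstile> Imp \<mu> (Know \<mu>)" "\<turnstile> Imp (Neg \<mu>) (Know (Neg \<mu>))"
  shows "\<turnstile> Iff (Poss (And \<phi> \<mu>)) (And (Poss \<phi>) \<mu>)"
proof -
  have "\<turnstile> Imp (Neg \<phi>) (Neg (And \<phi> \<mu>))" "\<turnstile> Imp (Neg \<mu>) (Neg (And \<phi> \<mu>))"
    "\<turnstile> Imp (And \<mu> (Neg (And \<phi> \<mu>))) (Neg \<phi>)"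
    by (rule prop_consequence[of "[]"]; auto)+
  note 1 = this[THEN Know_mono]
  show ?thesis
    using assms 1 Know_And[of \<mu> "Neg (And \<phi> \<mu>)"]
    by (intro prop_consequence[of "[Imp \<mu> (Know \<mu>), Imp (Neg \<mu>) (Know (Neg \<mu>)),
       Imp (Know (Neg \<phi>)) (Know (Neg (And \<phi> \<mu>))), Imp (Know (Neg \<mu>)) (Know (Neg (And \<phi> \<mu>))),
       Imp (Know (And \<mu> (Neg (And \<phi> \<mu>)))) (Know (Neg \<phi>)),
       Iff (Know (And \<mu> (Neg (And \<phi> \<mu>)))) (And (Know \<mu>) (Know (Neg (And \<phi> \<mu>))))]"]) auto
qed

lemma Dia_And:
  assumes "\<turnstile> Imp \<mu> (Box \<mu>)" "\<turnstile> Imp (Neg \<mu>) (Box (Neg \<mu>))"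
  shows "\<turnstile> Iff (Dia (And \<phi> \<mu>)) (And (Dia \<phi>) \<mu>)"
proof -
  have "\<turnstile> Imp (Neg \<phi>) (Neg (And \<phi> \<mu>))" "\<turnstile> Imp (Neg \<mu>) (Neg (And \<phi> \<mu>))"
    "\<turnstile> Imp (And \<mu> (Neg (And \<phi> \<mu>))) (Neg \<phi>)"
    by (rule prop_consequence[of "[]"]; auto)+
  note 1 = this[THEN Box_mono]
  show ?thesis
    using assms 1 Box_And[of \<mu> "Neg (And \<phi> \<mu>)"]
    by (intro prop_consequence[of "[Imp \<mu> (Box \<mu>), Imp (Neg \<mu>) (Box (Neg \<mu>)),
       Imp (Box (Neg \<phi>)) (Box (Neg (And \<phi> \<mu>))), Imp (Box (Neg \<mu>)) (Box (Neg (And \<phi> \<mu>))),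
       Imp (Box (And \<mu> (Neg (And \<phi> \<mu>)))) (Box (Neg \<phi>)),
       Iff (Box (And \<mu> (Neg (And \<phi> \<mu>)))) (And (Box \<mu>) (Box (Neg (And \<phi> \<mu>))))]"]) auto
qed

section \<open>Formulas decided by knowledge\<close>

definition epistemic :: "'a fm \<Rightarrow> bool" where
  "epistemic \<mu> \<longleftrightarrow> (\<turnstile> Imp \<mu> (Know \<mu>)) \<and> (\<turnstile> Imp (Neg \<mu>) (Know (Neg \<mu>)))"

text \<open>Negative introspection: \<open>KnowB\<close> for \<open>Neg (Know \<phi>)\<close>,
  followed by the contrapositive of positive introspection under \<open>Know\<close>.\<close>

lemma epistemic_Know: "epistemic (Know \<phi>)"
proof -
  have neg: "\<turnstile> Imp (Neg (Know \<phi>)) (Know (Neg (Know \<phi>)))"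
  proof -
    have a: "\<turnstile> Imp (Neg (Know \<phi>)) (Know (Poss (Neg (Know \<phi>))))" by (rule MPstar.KnowB)
    have "\<turnstile> Imp (Know \<phi>) (Know (Neg (Neg (Know \<phi>))))"
      using MPstar.Know4[of tt ff \<phi>] Iff_cong(3)[OF Neg_Neg[of "Know \<phi>"]]
      by (intro prop_consequence[of "[Imp (Know \<phi>) (Know (Know \<phi>)),
          Iff (Know (Neg (Neg (Know \<phi>)))) (Know (Know \<phi>))]"]) auto
    then have "\<turnstile> Imp (Poss (Neg (Know \<phi>))) (Neg (Know \<phi>))"
      by (intro prop_consequence[of "[Imp (Know \<phi>) (Know (Neg (Neg (Know \<phi>))))]"]) auto
    from Imp_trans[OF a Know_mono[OF this]] show ?thesis .
  qed
  then show ?thesis by (simp add: epistemic_def MPstar.Know4)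
qed

lemma epistemic_Neg:
  assumes "epistemic \<mu>"
  shows "epistemic (Neg \<mu>)"
  using assms Iff_cong(3)[OF Neg_Neg[of \<mu>]] unfolding epistemic_def
  by (auto intro: prop_consequence[of "[Imp \<mu> (Know \<mu>), Iff (Know (Neg (Neg \<mu>))) (Know \<mu>)]"])

lemma epistemic_Poss: "epistemic (Poss \<phi>)"
  unfolding Poss_def by (intro epistemic_Neg epistemic_Know)

lemma epistemic_And:
  assumes "epistemic \<mu>" "epistemic \<nu>"
  shows "epistemic (And \<mu> \<nu>)"
proof -
  have "\<turnstile> Imp (Neg \<mu>) (Neg (And \<mu> \<nu>))" "\<turnstile> Imp (Neg \<nu>) (Neg (And \<mu> \<nu>))"
    by (rule prop_consequence[of "[]"]; simp)+
  note 1 = this[THEN Know_mono]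
  show ?thesis
    using assms 1 Know_And[of \<mu> \<nu>] unfolding epistemic_def
    by (auto intro: prop_consequence[of "[Imp \<mu> (Know \<mu>), Imp \<nu> (Know \<nu>),
        Iff (Know (And \<mu> \<nu>)) (And (Know \<mu>) (Know \<nu>))]"]
      prop_consequence[of "[Imp (Neg \<mu>) (Know (Neg \<mu>)), Imp (Neg \<nu>) (Know (Neg \<nu>)),
       Imp (Know (Neg \<mu>)) (Know (Neg (And \<mu> \<nu>))), Imp (Know (Neg \<nu>)) (Know (Neg (And \<mu> \<nu>)))]"])
qed

section \<open>Formulas whose truth value is stable under shrinking the neighbourhood\<close>

definition persistent :: "'a fm \<Rightarrow> bool" where
  "persistent \<mu> \<longleftrightarrow> (\<turnstile> Imp \<mu> (Box \<mu>)) \<and> (\<turnstile> Imp (Neg \<mu>) (Box (Neg \<mu>)))"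

lemma persistent_And:
  assumes "persistent \<mu>" "persistent \<nu>"
  shows "persistent (And \<mu> \<nu>)"
proof -
  have "\<turnstile> Imp (Neg \<mu>) (Neg (And \<mu> \<nu>))" "\<turnstile> Imp (Neg \<nu>) (Neg (And \<mu> \<nu>))"
    by (rule prop_consequence[of "[]"]; simp)+
  note 1 = this[THEN Box_mono]
  show ?thesis
    using assms 1 Box_And[of \<mu> \<nu>] unfolding persistent_def
    by (auto intro: prop_consequence[of "[Imp \<mu> (Box \<mu>), Imp \<nu> (Box \<nu>),
        Iff (Box (And \<mu> \<nu>)) (And (Box \<mu>) (Box \<nu>))]"]
      prop_consequence[of "[Imp (Neg \<mu>) (Box (Neg \<mu>)), Imp (Neg \<nu>) (Box (Neg \<nu>)),
       Imp (Box (Neg \<mu>)) (Box (Neg (And \<mu> \<nu>))), Imp (Box (Neg \<nu>)) (Box (Neg (And \<mu> \<nu>)))]"])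
qed

lemma persistent_Neg:
  assumes "persistent \<mu>"
  shows "persistent (Neg \<mu>)"
  using assms Iff_cong(2)[OF Neg_Neg[of \<mu>]] unfolding persistent_def
  by (auto intro: prop_consequence[of "[Imp \<mu> (Box \<mu>), Iff (Box (Neg (Neg \<mu>))) (Box \<mu>)]"])

lemma persistent_Atom: "persistent (Atom x)"
  unfolding persistent_def using MPstar.AtomStable[of tt ff x]
  by (auto intro: prop_consequence[of "[And (Imp (Atom x) (Box (Atom x)))
     (Imp (Neg (Atom x)) (Box (Neg (Atom x))))]"])

text \<open>Persistence of \<open>\<mu>\<close> and the cross axiom give \<open>Know \<mu>\<close>
  implies \<open>Box (Know \<mu>)\<close>; under \<open>Dia\<close>, directedness then yields the
  positive half. The negative half is transitivity of \<open>Box\<close>.\<close>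

lemma persistent_Dia_Know:
  assumes "persistent \<mu>"
  shows "persistent (Dia (Know \<mu>))"
proof -
  have "\<turnstile> Imp (Know \<mu>) (Box (Know \<mu>))"
    using assms Imp_trans[OF Know_mono MPstar.Cross] by (simp add: persistent_def)
  from Imp_trans[OF Dia_mono[OF this] MPstar.Directed]
  have pos: "\<turnstile> Imp (Dia (Know \<mu>)) (Box (Dia (Know \<mu>)))" .
  have "\<turnstile> Imp (Box (Neg (Know \<mu>))) (Box (Neg (Dia (Know \<mu>))))"
    unfolding Dia_def
    by (rule Imp_trans[OF MPstar.Box4 Box_mono], rule prop_consequence[of "[]"]) auto
  then have "\<turnstile> Imp (Neg (Dia (Know \<mu>))) (Box (Neg (Dia (Know \<mu>))))"
    by (intro prop_consequence[of "[Imp (Box (Neg (Know \<mu>))) (Box (Neg (Dia (Know \<mu>))))]"]) auto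
  with pos show ?thesis by (simp add: persistent_def)
qed

lemma persistent_Lprime: "\<phi> \<in> Lprime \<Longrightarrow> persistent \<phi>"
  by (induction rule: Lprime.induct)
     (auto intro: persistent_Atom persistent_And persistent_Neg persistent_Dia_Know)

lemma persistent_Dia:
  assumes "persistent \<mu>"
  shows "\<turnstile> Imp (Dia \<mu>) \<mu>"
  using assms unfolding persistent_def
  by (auto intro: prop_consequence[of "[Imp (Neg \<mu>) (Box (Neg \<mu>))]"])

text \<open>The contrapositive of the cross axiom for \<open>Neg \<phi>\<close>.\<close>

lemma Dia_Poss: "\<turnstile> Imp (Dia (Poss \<phi>)) (Poss (Dia \<phi>))"
proof -
  have "\<turnstile> Imp (Know (Neg (Dia \<phi>))) (Know (Box (Neg \<phi>)))"
    by (rule Know_mono, rule prop_consequence[of "[]"]) auto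
  moreover have "\<turnstile> Imp (Box (Know (Neg \<phi>))) (Box (Neg (Poss \<phi>)))"
    by (rule Box_mono, rule prop_consequence[of "[]"]) auto
  ultimately show ?thesis using MPstar.Cross[of tt ff "Neg \<phi>"]
    by (intro prop_consequence[of "[Imp (Know (Neg (Dia \<phi>))) (Know (Box (Neg \<phi>))),
      Imp (Box (Know (Neg \<phi>))) (Box (Neg (Poss \<phi>))),
      Imp (Know (Box (Neg \<phi>))) (Box (Know (Neg \<phi>)))]"]) auto
qed

lemma Dia_Poss_persistent: "persistent \<mu> \<Longrightarrow> \<turnstile> Imp (Dia (Poss \<mu>)) (Poss \<mu>)"
  by (rule Imp_trans[OF Dia_Poss Poss_mono[OF persistent_Dia]])

subsection \<open>Equivalence\<close>

lemma dnf_and_correct: "\<turnstile> Iff (And (dnf_fm ff D) (dnf_fm ff E)) (dnf_fm ff (dnf_and D E))"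
proof (rule prop_consequence)
  \<comment> \<open>Distribution of \<open>Know\<close> over conjunction for every pair of triples
    is the only modal input; the rest is propositional distributivity.\<close>
  let ?\<Gamma> = "concat (map (\<lambda>p. map (\<lambda>q. Iff (Know (And (fst (snd p)) (fst (snd q))))
    (And (Know (fst (snd p))) (Know (fst (snd q))))) E) D)"
  show "\<forall>\<gamma>\<in>set ?\<Gamma>. \<turnstile> \<gamma>" by (auto intro: Know_And)
  fix v :: "'a fm \<Rightarrow> bool"
  assume v: "\<not> v (Atom ff)" and \<Gamma>: "\<forall>\<gamma>\<in>set ?\<Gamma>. prop_eval v \<gamma>"
  have "prop_eval v (prime_fm (prime_and p q)) \<longleftrightarrow> prop_eval v (prime_fm p) \<and> prop_eval v (prime_fm q)"
    if "p \<in> set D" "q \<in> set E" for p q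
  proof -
    from \<Gamma> that have "v (Know (And (fst (snd p)) (fst (snd q)))) \<longleftrightarrow>
        v (Know (fst (snd p))) \<and> v (Know (fst (snd q)))" by force
    then show ?thesis by (auto simp: prop_eval_prime_fm prime_and_def)
  qed
  then show "prop_eval v (Iff (And (dnf_fm ff D) (dnf_fm ff E)) (dnf_fm ff (dnf_and D E)))"
    using v by (auto simp: prop_eval_dnf_fm dnf_and_def)
qed

lemma Know_verum: "\<turnstile> Know (Atom tt)"
  by (rule MPstar.KnowNec, rule prop_consequence[of "[]"]) auto

lemma prime_neg_correct: "\<turnstile> Iff (Neg (prime_fm p)) (dnf_fm ff (prime_neg tt p))"
  using Know_verum Iff_cong(3)[OF Neg_Neg[of "fst (snd p)"]]
  by (intro prop_consequence[of "[Know (Atom tt),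
        Iff (Know (Neg (Neg (fst (snd p))))) (Know (fst (snd p)))]"])
     (auto simp: prop_eval_dnf_fm prop_eval_prime_fm prime_neg_def)

lemma dnf_neg_correct: "\<turnstile> Iff (Neg (dnf_fm ff D)) (dnf_fm ff (dnf_neg tt D))"
proof (induction D)
  case Nil
  show ?case using Know_verum
    by (intro prop_consequence[of "[Know (Atom tt)]"])
       (auto simp: prop_eval_dnf_fm prop_eval_prime_fm dnf_neg_def)
next
  case (Cons p D)
  let ?N = "prime_neg tt p" and ?M = "dnf_neg tt D"
  have "dnf_neg tt (p # D) = dnf_and ?N ?M" by (simp add: dnf_neg_def)
  then show ?case
    using Cons prime_neg_correct[of p] dnf_and_correct[of ?N ?M]
    by (intro prop_consequence[of "[Iff (Neg (dnf_fm ff D)) (dnf_fm ff ?M),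
      Iff (Neg (prime_fm p)) (dnf_fm ff ?N),
      Iff (And (dnf_fm ff ?N) (dnf_fm ff ?M)) (dnf_fm ff (dnf_and ?N ?M))]"])
      (auto simp: dnf_fm_def[of ff "p # D"] simp flip: dnf_fm_def)
qed

text \<open>To be used with \<open>Dia\<close> and \<open>Poss\<close> for \<open>M\<close>. The
  premise \<open>bot\<close> deals with the innermost false disjunct of \<open>dnf_fm\<close>, which
  \<open>map f\<close> leaves untouched.\<close>

lemma dnf_map_correct:
  assumes Or: "\<And>\<phi> \<psi>. \<turnstile> Iff (M (Or \<phi> \<psi>)) (Or (M \<phi>) (M \<psi>))"
    and bot: "\<turnstile> Imp (M (And (Atom ff) (Know (Atom ff)))) (And (Atom ff) (Know (Atom ff)))"
    and f: "\<forall>p\<in>set D. \<turnstile> Iff (M (prime_fm p)) (prime_fm (f p))"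
  shows "\<turnstile> Iff (M (dnf_fm ff D)) (dnf_fm ff (map f D))"
  using f
proof (induction D)
  case Nil
  show ?case unfolding dnf_fm_def using bot
    by (intro prop_consequence[of "[Imp (M (And (Atom ff) (Know (Atom ff))))
      (And (Atom ff) (Know (Atom ff)))]"]) auto
next
  case (Cons p D)
  let ?D = "dnf_fm ff D" and ?D' = "dnf_fm ff (map f D)"
  have "dnf_fm ff (p # D) = Or ?D (prime_fm p)"
    "dnf_fm ff (map f (p # D)) = Or ?D' (prime_fm (f p))"
    by (simp_all add: dnf_fm_def)
  then show ?case using Cons Or[of ?D "prime_fm p"]
    by (intro prop_consequence[of "[Iff (M (Or ?D (prime_fm p))) (Or (M ?D) (M (prime_fm p))),
      Iff (M ?D) ?D', Iff (M (prime_fm p)) (prime_fm (f p))]"]) auto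
qed

section \<open>Possibility and diamond of a single prime normal form\<close>

definition know_part :: "'a fm \<Rightarrow> 'a fm list \<Rightarrow> 'a fm" where
  "know_part b cs = foldr (\<lambda>c \<phi>. And \<phi> (Poss c)) cs (Know b)"

lemma know_part_simps [simp]:
  "know_part b [] = Know b"
  "know_part b (c # cs) = And (know_part b cs) (Poss c)"
  by (simp_all add: know_part_def)

lemma prop_eval_know_part:
  "prop_eval v (know_part b cs) \<longleftrightarrow> v (Know b) \<and> (\<forall>c\<in>set cs. \<not> v (Know (Neg c)))"
  by (induction cs) auto

text \<open>Both orders are recorded because the factor to be pulled out stands second: the
  epistemic part in \<open>Poss_And\<close>, the persistent component in
  \<open>Dia_And\<close>.\<close>

lemma prime_fm_know_part:
  "\<turnstile> Iff (prime_fm p) (And (fst p) (know_part (fst (snd p)) (snd (snd p))))"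
  "\<turnstile> Iff (prime_fm p) (And (know_part (fst (snd p)) (snd (snd p))) (fst p))"
  by (rule prop_consequence[of "[]"]; auto simp: prop_eval_prime_fm prop_eval_know_part)+

lemma epistemic_know_part: "epistemic (know_part b cs)"
  by (induction cs) (auto intro: epistemic_Know epistemic_And epistemic_Poss)

lemma prime_poss_correct: "\<turnstile> Iff (Poss (prime_fm p)) (prime_fm (prime_poss tt p))"
proof -
  let ?M = "know_part (fst (snd p)) (snd (snd p))"
  have "\<turnstile> Iff (Poss (prime_fm p)) (And (Poss (fst p)) ?M)"
    using Iff_trans[OF Iff_cong(5)[OF prime_fm_know_part(1)] Poss_And] epistemic_know_part
    by (auto simp: epistemic_def)
  then show ?thesis
    by (intro prop_consequence[of "[Iff (Poss (prime_fm p)) (And (Poss (fst p)) ?M)]"])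
       (auto simp: prop_eval_prime_fm prop_eval_know_part prime_poss_def)
qed

text \<open>Removes the diamond that the union axiom puts before \<open>know_part b cs\<close>. Each
  \<open>Poss c\<close> can be pulled back from a smaller neighbourhood to the current one;
  \<open>Know b\<close> in general cannot, hence it is a separate conjunct of the premise.\<close>

lemma Dia_know_part_persistent:
  assumes "\<forall>c\<in>set cs. persistent c"
  shows "\<turnstile> Imp (And (Know b) (Dia (know_part b cs))) (know_part b cs)"
  using assms
proof (induction cs)
  case Nil
  show ?case by (rule prop_consequence[of "[]"]) auto
next
  case (Cons c cs)
  let ?M = "know_part b cs"
  have "\<turnstile> Imp (And ?M (Poss c)) ?M" "\<turnstile> Imp (And ?M (Poss c)) (Poss c)"
    by (rule prop_consequence[of "[]"]; simp)+
  note 1 = this[THEN Dia_mono]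
  show ?case using 1 Cons Dia_Poss_persistent[of c]
    by (intro prop_consequence[of "[Imp (Dia (And ?M (Poss c))) (Dia ?M),
       Imp (Dia (And ?M (Poss c))) (Dia (Poss c)), Imp (Dia (Poss c)) (Poss c),
       Imp (And (Know b) (Dia ?M)) ?M]"]) auto
qed

text \<open>The union axiom adds one \<open>Poss\<close>-conjunct at a time.\<close>

lemma Dia_know_part_step:
  assumes b: "persistent b" and c: "persistent c"
    and cs: "\<forall>c\<in>set cs. persistent c"
  shows "\<turnstile> Iff (Dia (And (know_part b cs) (Poss c)))
                (And (Dia (know_part b cs)) (Poss (And c (Dia (Know b)))))"
proof -
  let ?M = "know_part b cs"
  \<comment> \<open>The bridge between the conjunct \<open>Poss (And c (Dia (Know b)))\<close> and
    the second premise of the union axiom.\<close>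
  have Dia_c: "\<turnstile> Iff (Dia (And (Know b) c)) (And c (Dia (Know b)))"
    using Dia_And[of c "Know b"] c
    by (intro prop_consequence[of "[Iff (Dia (And (Know b) c)) (And (Dia (Know b)) c)]"])
       (auto simp: persistent_def)
  have "\<turnstile> Imp (And ?M (Poss c)) (Poss (And (Know b) c))"
  proof -
    have "\<turnstile> Iff (Poss (And c (Know b))) (And (Poss c) (Know b))"
      using epistemic_Know[of b] by (intro Poss_And) (auto simp: epistemic_def)
    moreover have "\<turnstile> Iff (Poss (And c (Know b))) (Poss (And (Know b) c))"
      by (rule Iff_cong(5), rule prop_consequence[of "[]"]) auto
    ultimately show ?thesis
      by (intro prop_consequence[of "[Iff (Poss (And c (Know b))) (And (Poss c) (Know b)),
         Iff (Poss (And c (Know b))) (Poss (And (Know b) c))]"]) (auto simp: prop_eval_know_part)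
  qed
  from Imp_trans[OF Imp_trans[OF Dia_mono[OF this] Dia_Poss] Poss_mono[OF IffD(1)[OF Dia_c]]]
  have fwd2: "\<turnstile> Imp (Dia (And ?M (Poss c))) (Poss (And c (Dia (Know b))))" .
  have fwd1: "\<turnstile> Imp (Dia (And ?M (Poss c))) (Dia ?M)"
    by (rule Dia_mono, rule prop_consequence[of "[]"]) auto
  \<comment> \<open>Repeating \<open>Know b\<close> brings \<open>?M\<close> into the shape of the
    first premise of the union axiom.\<close>
  have bwd1: "\<turnstile> Imp (Dia ?M) (Dia (And (Know b) ?M))"
    by (rule Dia_mono, rule prop_consequence[of "[]"]) (auto simp: prop_eval_know_part)
  note bwd2 = Poss_mono[OF IffD(2)[OF Dia_c]]
  \<comment> \<open>Cleaning the conclusion of the union axiom under its outer diamond: persistence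
    of \<open>b\<close> restores \<open>Know b\<close>, which in turn allows the diamond before
    \<open>?M\<close> to be dropped; persistence of \<open>c\<close> restores
    \<open>Poss c\<close>.\<close>
  have bwd3: "\<turnstile> Imp (Dia (And (And (Know (Dia b)) (Dia ?M)) (Poss (Dia c)))) (Dia (And ?M (Poss c)))"
    using Know_mono[OF persistent_Dia[OF b]] Poss_mono[OF persistent_Dia[OF c]]
      Dia_know_part_persistent[OF cs, of b]
    by (intro Dia_mono prop_consequence[of "[Imp (Know (Dia b)) (Know b),
        Imp (Poss (Dia c)) (Poss c), Imp (And (Know b) (Dia ?M)) ?M]"]) auto
  show ?thesis
    using fwd1 fwd2 bwd1 bwd2 bwd3 MPstar.Union[of tt ff b ?M c]
    by (intro prop_consequence[of "[Imp (Dia (And ?M (Poss c))) (Dia ?M),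
      Imp (Dia (And ?M (Poss c))) (Poss (And c (Dia (Know b)))),
      Imp (Dia ?M) (Dia (And (Know b) ?M)),
      Imp (Poss (And c (Dia (Know b)))) (Poss (Dia (And (Know b) c))),
      Imp (Dia (And (And (Know (Dia b)) (Dia ?M)) (Poss (Dia c)))) (Dia (And ?M (Poss c))),
      Imp (And (Dia (And (Know b) ?M)) (Poss (Dia (And (Know b) c))))
        (Dia (And (And (Know (Dia b)) (Dia ?M)) (Poss (Dia c))))]"]) auto
qed

lemma Dia_know_part:
  assumes "persistent b" "\<forall>c\<in>set cs. persistent c"
  shows "\<turnstile> Iff (Dia (know_part b cs))
    (foldr (\<lambda>c \<phi>. And \<phi> (Poss (And c (Dia (Know b))))) cs (Dia (Know b)))"
  using assms(2)
proof (induction cs)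
  case Nil
  show ?case by (rule prop_consequence[of "[]"]) auto
next
  case (Cons c cs)
  let ?M = "know_part b cs"
    and ?F = "foldr (\<lambda>c \<phi>. And \<phi> (Poss (And c (Dia (Know b))))) cs (Dia (Know b))"
  show ?case using Cons Dia_know_part_step[OF assms(1), of c cs]
    by (intro prop_consequence[of "[Iff (Dia ?M) ?F, Iff (Dia (And ?M (Poss c)))
       (And (Dia ?M) (Poss (And c (Dia (Know b)))))]"]) auto
qed

lemma prime_dia_correct:
  assumes "Lprime_prime p"
  shows "\<turnstile> Iff (Dia (prime_fm p)) (prime_fm (prime_dia tt p))"
proof -
  obtain a b cs where p: "p = (a, b, cs)" by (cases p)
  from assms have pers: "persistent a" "persistent b" "\<forall>c\<in>set cs. persistent c"
    by (auto simp: p Lprime_prime_def intro: persistent_Lprime)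
  let ?M = "know_part b cs"
  let ?F = "foldr (\<lambda>c \<phi>. And \<phi> (Poss (And c (Dia (Know b))))) cs (Dia (Know b))"
  have F: "prop_eval v ?F \<longleftrightarrow> \<not> v (Box (Neg (Know b))) \<and>
      (\<forall>c\<in>set cs. \<not> v (Know (Neg (And c (Dia (Know b))))))" for v
    by (induction cs) auto
  \<comment> \<open>The persistent component \<open>a\<close> leaves the diamond; what remains is
    \<open>Dia_know_part\<close>, with the theorem \<open>Know (Atom tt)\<close> filling the
    \<open>Know\<close> slot.\<close>
  have "\<turnstile> Iff (Dia (prime_fm p)) (And (Dia ?M) a)"
    using Iff_trans[OF Iff_cong(4)[OF prime_fm_know_part(2)[of p]] Dia_And] pers(1)
    by (simp add: p persistent_def)
  then show ?thesis using Dia_know_part[OF pers(2,3)] Know_verum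
    by (intro prop_consequence[of "[Iff (Dia (prime_fm p)) (And (Dia ?M) a), Iff (Dia ?M) ?F,
       Know (Atom tt)]"]) (auto simp: F prop_eval_prime_fm prime_dia_def p)
qed

section \<open>Both modalities on disjunctions, and the induction on formulas\<close>

lemma dnf_poss_correct: "\<turnstile> Iff (Poss (dnf_fm ff D)) (dnf_fm ff (map (prime_poss tt) D))"
proof (rule dnf_map_correct)
  have "\<turnstile> Know (Neg (And (Atom ff) (Know (Atom ff))))"
    by (rule MPstar.KnowNec, rule prop_consequence[of "[]"]) auto
  then show "\<turnstile> Imp (Poss (And (Atom ff) (Know (Atom ff)))) (And (Atom ff) (Know (Atom ff)))"
    by (intro prop_consequence[of "[Know (Neg (And (Atom ff) (Know (Atom ff))))]"]) auto
qed (auto intro: Poss_Or prime_poss_correct)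

lemma dnf_dia_correct:
  assumes "\<forall>p\<in>set D. Lprime_prime p"
  shows "\<turnstile> Iff (Dia (dnf_fm ff D)) (dnf_fm ff (map (prime_dia tt) D))"
proof (rule dnf_map_correct)
  have "\<turnstile> Box (Neg (And (Atom ff) (Know (Atom ff))))"
    by (rule MPstar.BoxNec, rule prop_consequence[of "[]"]) auto
  then show "\<turnstile> Imp (Dia (And (Atom ff) (Know (Atom ff)))) (And (Atom ff) (Know (Atom ff)))"
    by (intro prop_consequence[of "[Box (Neg (And (Atom ff) (Know (Atom ff))))]"]) auto
qed (use assms in \<open>auto intro: Dia_Or prime_dia_correct\<close>)

lemma dnf_correct: "\<turnstile> Iff \<phi> (dnf_fm ff (dnf tt \<phi>))"
proof (induction \<phi>)
  case (Atom a)
  show ?case using Know_verum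
    by (intro prop_consequence[of "[Know (Atom tt)]"])
       (auto simp: prop_eval_dnf_fm prop_eval_prime_fm)
next
  case (Neg \<phi>)
  show ?case using Iff_trans[OF Iff_cong(1)[OF Neg] dnf_neg_correct] by simp
next
  case (And \<phi> \<psi>)
  then show ?case using dnf_and_correct[of "dnf tt \<phi>" "dnf tt \<psi>"]
    by (intro prop_consequence[of "[Iff \<phi> (dnf_fm ff (dnf tt \<phi>)), Iff \<psi> (dnf_fm ff (dnf tt \<psi>)),
      Iff (And (dnf_fm ff (dnf tt \<phi>)) (dnf_fm ff (dnf tt \<psi>)))
        (dnf_fm ff (dnf_and (dnf tt \<phi>) (dnf tt \<psi>)))]"]) auto
next
  case (Box \<phi>)
  note neg = Iff_trans[OF Iff_cong(1)[OF Box] dnf_neg_correct]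
  \<comment> \<open>Distributing the diamond over triples uses persistence, so the shape lemmas
    enter the equivalence here.\<close>
  have "\<turnstile> Iff (Dia (Neg \<phi>)) (dnf_fm ff (map (prime_dia tt) (dnf_neg tt (dnf tt \<phi>))))"
    by (rule Iff_trans[OF Iff_cong(4)[OF neg] dnf_dia_correct]) (intro dnf_neg_Lprime dnf_Lprime)
  from Iff_trans[OF Iff_cong(1)[OF this] dnf_neg_correct]
  have "\<turnstile> Iff (Neg (Dia (Neg \<phi>))) (dnf_fm ff (dnf tt (Box \<phi>)))" by simp
  \<comment> \<open>\<open>Neg (Dia (Neg \<phi>))\<close> hides
    \<open>Box (Neg (Neg \<phi>))\<close>, opaque to valuations; the double negation has to be
    removed under \<open>Box\<close>.\<close>
  then show ?case using Iff_cong(2)[OF Neg_Neg[of \<phi>]]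
    by (intro prop_consequence[of "[Iff (Neg (Dia (Neg \<phi>))) (dnf_fm ff (dnf tt (Box \<phi>))),
       Iff (Box (Neg (Neg \<phi>))) (Box \<phi>)]"]) auto
next
  case (Know \<phi>)
  note neg = Iff_trans[OF Iff_cong(1)[OF Know] dnf_neg_correct]
  have "\<turnstile> Iff (Poss (Neg \<phi>)) (dnf_fm ff (map (prime_poss tt) (dnf_neg tt (dnf tt \<phi>))))"
    by (rule Iff_trans[OF Iff_cong(5)[OF neg] dnf_poss_correct])
  from Iff_trans[OF Iff_cong(1)[OF this] dnf_neg_correct]
  have "\<turnstile> Iff (Neg (Poss (Neg \<phi>))) (dnf_fm ff (dnf tt (Know \<phi>)))" by simp
  then show ?case using Iff_cong(3)[OF Neg_Neg[of \<phi>]]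
    by (intro prop_consequence[of "[Iff (Neg (Poss (Neg \<phi>))) (dnf_fm ff (dnf tt (Know \<phi>))),
       Iff (Know (Neg (Neg \<phi>))) (Know \<phi>)]"]) auto
qed

end

subsection \<open>Computability\<close>

abbreviation enc_prime :: "('a \<Rightarrow> nat) \<Rightarrow> 'a prime \<Rightarrow> nat" where
  "enc_prime code \<equiv> enc_pair (goedel code) (enc_pair (goedel code) (enc_list (goedel code)))"

text \<open>For the unary constructors the second premise of \<open>computable_enc_goedel\<close> is
  met by a constant function.\<close>

lemmas computable_enc_Neg = computable_enc_goedel(1)[OF _ computable_enc_const]
lemmas computable_enc_And = computable_enc_goedel(2)
lemmas computable_enc_Box = computable_enc_goedel(3)[OF _ computable_enc_const]
lemmas computable_enc_Know = computable_enc_goedel(4)[OF _ computable_enc_const]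

lemmas computable_enc_intros =
  computable_enc_const computable_enc_Neg computable_enc_And computable_enc_Box computable_enc_Know
  computable_enc_Pair computable_enc_fst computable_enc_snd computable_enc_Cons
  computable_enc_append computable_enc_id

lemma computable_prime_fm: "computable_enc (enc_prime code) (goedel code) prime_fm"
  unfolding prime_fm_def Poss_def
  by (rule computable_enc_foldr computable_enc_intros)+

lemma computable_dnf_fm: "computable_enc (enc_list (enc_prime code)) (goedel code) (dnf_fm ff)"
  unfolding dnf_fm_def Or_def
  by (rule computable_enc_foldr computable_enc_comp[OF computable_prime_fm] computable_enc_intros)+

lemma computable_dnf_and:
  assumes "computable_enc e (enc_list (enc_prime code)) f"
    and "computable_enc e (enc_list (enc_prime code)) g"
  shows "computable_enc e (enc_list (enc_prime code)) (\<lambda>z. dnf_and (f z) (g z))"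
proof -
  have "computable_enc (enc_pair (enc_list (enc_prime code)) (enc_list (enc_prime code)))
     (enc_list (enc_prime code)) (\<lambda>z. dnf_and (fst z) (snd z))"
    unfolding dnf_and_def prime_and_def
    by (rule computable_enc_concat computable_enc_map computable_enc_intros)+
  from computable_enc_comp[OF this computable_enc_Pair[OF assms]] show ?thesis by simp
qed

lemma computable_prime_neg:
  "computable_enc (enc_prime code) (enc_list (enc_prime code)) (prime_neg tt)"
  unfolding prime_neg_def
  by (rule computable_enc_map computable_enc_intros)+

lemma computable_dnf_neg:
  "computable_enc (enc_list (enc_prime code)) (enc_list (enc_prime code)) (dnf_neg tt)"
  unfolding dnf_neg_def
  by (rule computable_enc_foldr computable_dnf_and computable_enc_comp[OF computable_prime_neg]
      computable_enc_intros)+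

lemma computable_prime_poss: "computable_enc (enc_prime code) (enc_prime code) (prime_poss tt)"
  unfolding prime_poss_def by (rule computable_enc_intros)+

lemma computable_prime_dia: "computable_enc (enc_prime code) (enc_prime code) (prime_dia tt)"
  unfolding prime_dia_def Dia_def by (rule computable_enc_map computable_enc_intros)+

lemma computable_dnf: "computable_enc (goedel code) (enc_list (enc_prime code)) (dnf tt)"
proof (rule computable_enc_rec_fm)
  let ?e = "enc_list (enc_prime code)"
  \<comment> \<open>Placing the whole formula \<open>\<phi>\<close> in the first component agrees
    with \<open>dnf\<close> on atoms and avoids decoding.\<close>
  show "computable_enc (goedel code) ?e (\<lambda>\<phi>. [(\<phi>, Atom tt, [])])"
    by (rule computable_enc_intros)+
  show "computable_enc ?e ?e (dnf_neg tt)" by (rule computable_dnf_neg)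
  show "computable_enc (enc_pair ?e ?e) ?e (\<lambda>z. dnf_and (fst z) (snd z))"
    by (rule computable_dnf_and computable_enc_intros)+
  show "computable_enc ?e ?e (\<lambda>D. dnf_neg tt (map (prime_dia tt) (dnf_neg tt D)))"
    by (rule computable_enc_comp[OF computable_dnf_neg] computable_enc_map
        computable_enc_comp[OF computable_prime_dia] computable_enc_intros)+
  show "computable_enc ?e ?e (\<lambda>D. dnf_neg tt (map (prime_poss tt) (dnf_neg tt D)))"
    by (rule computable_enc_comp[OF computable_dnf_neg] computable_enc_map
        computable_enc_comp[OF computable_prime_poss] computable_enc_intros)+
qed simp_all

theorem mainTheorem13:
  fixes tt ff :: 'a and code :: "'a \<Rightarrow> nat"
  assumes "tt \<noteq> ff" and "inj code"
  shows "\<exists>nf :: 'a fm \<Rightarrow> 'a fm. computable_fm code nf \<and>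
           (\<forall>\<phi>. disjunctive_nf (nf \<phi>) \<and> MPstar tt ff (Iff \<phi> (nf \<phi>)))"
proof (intro exI conjI allI)
  have "computable_enc (goedel code) (goedel code) (\<lambda>\<phi>. dnf_fm ff (dnf tt \<phi>))"
    by (rule computable_enc_comp[OF computable_dnf_fm computable_dnf])
  then obtain F where F: "computable F"
    "\<And>\<phi>. F (goedel code \<phi>) = goedel code (dnf_fm ff (dnf tt \<phi>))"
    unfolding computable_enc_def by blast
  show "computable_fm code (\<lambda>\<phi>. dnf_fm ff (dnf tt \<phi>))"
    unfolding computable_fm_def
    by (rule exI[of _ "\<lambda>xs. F (xs ! 0)"]) (use F in \<open>simp add: computable_def\<close>)
next
  fix \<phi> :: "'a fm"
  show "disjunctive_nf (dnf_fm ff (dnf tt \<phi>))"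
    by (intro disjunctive_nf_dnf_fm dnf_Lprime)
  show "MPstar tt ff (Iff \<phi> (dnf_fm ff (dnf tt \<phi>)))"
    by (rule dnf_correct)
qed

end
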